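(* Let $S=\{x^2+c_1,\dots,x^2+c_s\}$ with $c_i\in\mathbb{Z}[t]$, and suppose that: (1) some $c_j$ satisfies $\frac{d}{dt}(\overline{c_j})=1$ in $\mathbb{F}_2[t]$; (2) some $c_k$ with odd leading coefficient satisfies $\deg(c_k)=\max\{\deg(c_1),\dots,\deg(c_s)\}$. Let $\gamma=(\theta_n)_{n\ge1}$ be a sequence of elements of $S$ with $\theta_1(0)=c_j$, and let $n\ge 1$ be such that $\theta_n(0)=c_k$. Then $\gamma$ is stable over $\mathbb{Q}(t)$ and $K_n(\gamma)/K_{n-1}(\gamma)$ is maximal.
   Context: $\overline{c}$ denotes the reduction of $c\in\mathbb{Z}[t]$ modulo $2$ in $\mathbb{F}_2[t]$. Let $K=\mathbb{Q}(t)$. For $\gamma=(\theta_n)_{n\ge1}$ let $\gamma_n=\theta_1\circ\cdots\circ\theta_n$ and $K_n(\gamma)$ the splitting field of $\gamma_n$ over $K$ (with $K_0(\gamma)=K$). $\gamma$ is stable over $K$ if $\gamma_n$ is irreducible in $K[x]$ for all $n\ge1$; $K_n(\gamma)/K_{n-1}(\gamma)$ is maximal if $[K_n(\gamma):K_{n-1}(\gamma)]=2^{2^{n-1}}$. *)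

theory Defs
  imports "HOL-Algebra.Algebraic_Closure_Type" "HOL-Algebra.Generated_Fields" "HOL-Library.Z2"
begin

text \<open>A sequence \<open>\<gamma> = (\<theta>\<^sub>n)\<close> with \<open>n \<ge> 1\<close> is given by a function on
  \<^typ>\<open>nat\<close> whose value at \<open>0\<close> is never used.\<close>

primrec comp_seq :: "(nat \<Rightarrow> 'a::comm_ring_1 poly) \<Rightarrow> nat \<Rightarrow> 'a poly" where
  "comp_seq \<theta> 0 = [:0, 1:]"
| "comp_seq \<theta> (Suc n) = comp_seq \<theta> n \<circ>\<^sub>p \<theta> (Suc n)"

definition stable_seq :: "(nat \<Rightarrow> 'a::field poly) \<Rightarrow> bool" where
  "stable_seq \<theta> \<longleftrightarrow> (\<forall>n\<ge>1. Factorial_Ring.irreducible (comp_seq \<theta> n))"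

text \<open>All splitting fields are formed inside one fixed algebraic closure of the base field,
  so that they are comparable as sets.\<close>

abbreviation ac_ring :: "'a::field alg_closure ring" where
  "ac_ring \<equiv> ring_of_type_algebra"

definition splitting_field :: "'a::field poly \<Rightarrow> 'a alg_closure set" where
  "splitting_field p =
     generate_field ac_ring (range to_ac \<union> {z. poly (map_poly to_ac p) z = 0})"

definition seq_field :: "(nat \<Rightarrow> 'a::field poly) \<Rightarrow> nat \<Rightarrow> 'a alg_closure set" where
  "seq_field \<theta> n = splitting_field (comp_seq \<theta> n)"

text \<open>The relation \<^term>\<open>ring.dimension R d F E\<close> says that \<open>E\<close> has finite dimension exactly \<open>d\<close>
  over the subfield \<open>F\<close>.  Only meaningful for \<open>n \<ge> 1\<close>.\<close>

definition maximal_ext :: "(nat \<Rightarrow> 'a::field poly) \<Rightarrow> nat \<Rightarrow> bool" where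
  "maximal_ext \<theta> n \<longleftrightarrow>
     ring.dimension ac_ring (2 ^ 2 ^ (n - 1)) (seq_field \<theta> (n - 1)) (seq_field \<theta> n)"

type_synonym Qt = "rat poly fract"

definition Qt_of :: "int poly \<Rightarrow> Qt" where
  "Qt_of c = Fraction_Field.Fract (map_poly of_int c) 1"

definition red2 :: "int poly \<Rightarrow> bit poly" where
  "red2 c = map_poly of_int c"

definition quad :: "int poly \<Rightarrow> Qt poly" where
  "quad c = [:Qt_of c, 0, 1:]"

end

theory Submission
  imports Defs
begin

text \<open>
  Let \<open>\<theta>\<^sub>i = x\<^sup>2 + a i\<close>. Modulo 2 the derivative of \<open>\<gamma>\<^sub>m(0) \<in> \<int>[t]\<close> is that of \<open>a 1\<close>, namely 1. Hence
  \<open>\<plusminus>\<gamma>\<^sub>m(0)\<close> is never a square, which gives stability. It also shows that \<open>\<gamma>\<^sub>n(0)\<close>, whose leading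
  coefficient is odd, is squarefree; comparing degrees with the product of the \<open>\<gamma>\<^sub>m(0)\<close> for
  \<open>m < n\<close> yields a complex number \<open>z\<close> that is a simple zero of \<open>\<gamma>\<^sub>n(0)\<close> and no zero of an earlier
  \<open>\<gamma>\<^sub>m(0)\<close>.

  Map \<open>\<rat>(t)\<close> to Laurent series by expanding at \<open>z\<close>. Only square roots of units are needed to extend
  this map to the splitting field of \<open>\<gamma>\<^bsub>n-1\<^esub>\<close>. As \<open>\<gamma>\<^sub>n(0)\<close> is the product of the \<open>a n - \<beta>\<close> over the
  roots \<open>\<beta>\<close> of \<open>\<gamma>\<^bsub>n-1\<^esub>\<close> and has valuation 1, exactly one \<open>a n - \<beta>\<close> is not a unit, and since \<open>\<gamma>\<^bsub>n-1\<^esub>\<close>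
  is irreducible the embedding can be chosen so that this happens for any prescribed \<open>\<beta>\<close>. The
  embedding then extends to all \<open>sqrt (\<beta>' - a n)\<close> with \<open>\<beta>' \<noteq> \<beta>\<close>, while \<open>\<beta> - a n\<close> has odd valuation
  and no square root. So adjoining the \<open>2\<^bsup>n-1\<^esup>\<close> square roots one at a time doubles the degree every time.
\<close>

section \<open>Ring homomorphisms and nested quadratics\<close>

text \<open>The embeddings built later are total functions that are meaningful only on a growing
  subfield, so the homomorphism laws are relativised to a set.\<close>

definition hom_on :: "'a::comm_ring_1 set \<Rightarrow> ('a \<Rightarrow> 'b::comm_ring_1) \<Rightarrow> bool" where
  "hom_on S h \<longleftrightarrow> h 1 = 1 \<and> (\<forall>x\<in>S. \<forall>y\<in>S. h (x + y) = h x + h y \<and> h (x * y) = h x * h y)"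

lemma hom_onD:
  assumes "hom_on S h"
  shows "h 1 = 1" "x \<in> S \<Longrightarrow> y \<in> S \<Longrightarrow> h (x + y) = h x + h y"
    "x \<in> S \<Longrightarrow> y \<in> S \<Longrightarrow> h (x * y) = h x * h y"
  using assms unfolding hom_on_def by auto

lemma hom_on_zero:
  assumes "hom_on S h" "0 \<in> S"
  shows "h 0 = 0"
  using hom_onD(2)[OF assms(1) assms(2) assms(2)] by simp

lemma hom_on_uminus:
  assumes "hom_on S h" "0 \<in> S" "x \<in> S" "- x \<in> S"
  shows "h (- x) = - h x"
  using hom_onD(2)[OF assms(1) assms(3,4)] hom_on_zero[OF assms(1,2)]
  by (simp add: eq_neg_iff_add_eq_0 add.commute)

lemma hom_on_diff:
  assumes "hom_on S h" "0 \<in> S" "x \<in> S" "y \<in> S" "- y \<in> S"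
  shows "h (x - y) = h x - h y"
  using hom_onD(2)[OF assms(1) assms(3,5)] hom_on_uminus[OF assms(1,2,4,5)] by simp

lemma hom_on_map_poly:
  fixes h :: "'a::comm_ring_1 \<Rightarrow> 'b::comm_ring_1"
  assumes h: "hom_on UNIV h"
  shows "hom_on UNIV (map_poly h)"
proof -
  have h0: "h 0 = 0" using hom_on_zero[OF h] by simp
  have add: "map_poly h (p + q) = map_poly h p + map_poly h q" for p q
    by (rule poly_eqI) (simp add: coeff_map_poly h0 hom_onD(2)[OF h])
  have smult: "map_poly h (Polynomial.smult c p) = Polynomial.smult (h c) (map_poly h p)" for c p
    by (rule poly_eqI) (simp add: coeff_map_poly h0 hom_onD(3)[OF h])
  have "map_poly h (p * q) = map_poly h p * map_poly h q" for p q
    by (induction p) (simp_all add: map_poly_pCons h0 add smult)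
  then show ?thesis
    by (simp add: hom_on_def add hom_onD(1)[OF h])
qed

lemma hom_on_comp: "hom_on S g \<Longrightarrow> g ` S \<subseteq> T \<Longrightarrow> hom_on T h \<Longrightarrow> hom_on S (h \<circ> g)"
  unfolding hom_on_def by (auto simp: image_subset_iff)

lemma map_poly_pcompose_hom:
  assumes h: "hom_on UNIV h"
  shows "map_poly h (p \<circ>\<^sub>p q) = map_poly h p \<circ>\<^sub>p map_poly h q"
  using hom_on_map_poly[OF h]
  by (induction p)
    (simp_all add: map_poly_pCons hom_on_zero[OF h] hom_onD pcompose_pCons)

lemma map_poly_pderiv_hom:
  fixes h :: "'a::idom \<Rightarrow> 'b::idom"
  assumes h: "hom_on UNIV h"
  shows "map_poly h (pderiv p) = pderiv (map_poly h p)"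
proof -
  have "h (of_nat n) = of_nat n" for n
    by (induction n) (simp_all add: hom_on_zero[OF h] hom_onD[OF h])
  from this[of "Suc _"] show ?thesis
    by (intro poly_eqI)
      (simp add: coeff_map_poly coeff_pderiv hom_on_zero[OF h] hom_onD(3)[OF h] del: of_nat_Suc)
qed

lemma hom_on_of_int: "hom_on UNIV (of_int :: int \<Rightarrow> 'a::comm_ring_1)"
  by (simp add: hom_on_def)

lemma hom_on_of_rat: "hom_on UNIV (of_rat :: rat \<Rightarrow> 'a::field_char_0)"
  by (simp add: hom_on_def of_rat_add of_rat_mult)

lemma hom_on_to_ac: "hom_on UNIV (to_ac :: 'a::field \<Rightarrow> 'a alg_closure)"
  by (simp add: hom_on_def)

text \<open>\<open>nest a m\<close> is the polynomial function of \<open>\<gamma>\<^sub>m\<close> for \<open>\<theta>\<^sub>i = x\<^sup>2 + a i\<close>; it makes sense in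
  \<open>\<int>[t]\<close>, in power series and in the constants alike.\<close>

primrec nest :: "(nat \<Rightarrow> 'a::comm_ring_1) \<Rightarrow> nat \<Rightarrow> 'a \<Rightarrow> 'a" where
  "nest a 0 x = x"
| "nest a (Suc m) x = nest a m (x ^ 2 + a (Suc m))"

text \<open>The map applied last is \<open>x^2 + a 1\<close>. Modulo 2 a square has derivative zero,
  so this shape leaves only the derivative of \<open>a 1\<close>.\<close>

lemma nest_Suc_outer: "\<exists>y. nest a (Suc m) x = y ^ 2 + a 1"
  by (induction m arbitrary: x) (auto intro: exI[of _ x])

lemma nest_hom_on:
  assumes h: "hom_on S h"
    and S: "\<And>x y. x \<in> S \<Longrightarrow> y \<in> S \<Longrightarrow> x + y \<in> S \<and> x * y \<in> S" "\<And>i. a i \<in> S" "x \<in> S"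
  shows "nest a m x \<in> S \<and> h (nest a m x) = nest (\<lambda>i. h (a i)) m (h x)"
  using S(3)
proof (induction m arbitrary: x)
  case (Suc m)
  then show ?case
    using S(1)[of "x * x" "a (Suc m)"] S(1)[of x x] S(2)[of "Suc m"] Suc.IH[of "x * x + a (Suc m)"]
    by (simp add: power2_eq_square hom_onD[OF h])
qed simp

lemma nest_hom:
  assumes "hom_on UNIV h"
  shows "h (nest a m x) = nest (\<lambda>i. h (a i)) m (h x)"
  using nest_hom_on[OF assms, of a x m] by simp

lemma comp_seq_cong: "(\<And>m. m \<ge> 1 \<Longrightarrow> \<theta> m = \<theta>' m) \<Longrightarrow> comp_seq \<theta> m = comp_seq \<theta>' m"
  by (induction m) auto

lemma poly_comp_seq: "poly (comp_seq (\<lambda>m. [:a m, 0, 1:]) m) x = nest a m x"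
  by (induction m arbitrary: x) (simp_all add: poly_pcompose power2_eq_square add.commute)

lemma map_poly_comp_seq:
  assumes h: "hom_on UNIV h"
  shows "map_poly h (comp_seq (\<lambda>m. [:a m, 0, 1:]) m) = comp_seq (\<lambda>m. [:h (a m), 0, 1:]) m"
  by (induction m)
    (simp_all add: map_poly_pcompose_hom[OF h] map_poly_pCons hom_on_zero[OF h] hom_onD[OF h])

lemma monic_comp_seq:
  fixes a :: "nat \<Rightarrow> 'a::idom"
  shows "Polynomial.degree (comp_seq (\<lambda>m. [:a m, 0, 1:]) m) = 2 ^ m \<and>
    Polynomial.lead_coeff (comp_seq (\<lambda>m. [:a m, 0, 1:]) m) = 1"
proof (induction m)
  case (Suc m)
  let ?p = "comp_seq (\<lambda>m. [:a m, 0, 1:]) m"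
  have "Polynomial.lead_coeff (?p \<circ>\<^sub>p [:a (Suc m), 0, 1:]) = Polynomial.lead_coeff ?p"
    by (subst lead_coeff_comp) simp_all
  moreover have "Polynomial.degree (?p \<circ>\<^sub>p [:a (Suc m), 0, 1:]) = 2 ^ Suc m"
    using Suc.IH by (simp add: degree_pcompose)
  ultimately show ?case
    using Suc.IH unfolding comp_seq.simps by metis
qed simp

section \<open>Irreducibility of quadratic compositions\<close>

lemma poly_even_odd_parts:
  fixes p :: "'a::comm_ring_1 poly"
  shows "\<exists>u v. p = u \<circ>\<^sub>p [:0, 0, 1:] + [:0, 1:] * (v \<circ>\<^sub>p [:0, 0, 1:])"
proof (induction p)
  case 0
  have "0 = 0 \<circ>\<^sub>p [:0, 0, 1:] + [:0, 1:] * ((0::'a poly) \<circ>\<^sub>p [:0, 0, 1:])" by simp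
  then show ?case by blast
next
  case (pCons c p)
  then obtain u v where p: "p = u \<circ>\<^sub>p [:0, 0, 1:] + [:0, 1:] * (v \<circ>\<^sub>p [:0, 0, 1:])" by blast
  \<comment> \<open>Multiplication by x exchanges the two parts, since x times the old odd part is a
    polynomial in \<open>x^2\<close>.\<close>
  have "pCons c p = pCons c v \<circ>\<^sub>p [:0, 0, 1:] + [:0, 1:] * (u \<circ>\<^sub>p [:0, 0, 1:])"
    unfolding p by (simp add: pcompose_pCons algebra_simps)
  then show ?case by blast
qed

text \<open>For nonzero \<open>v\<close> the degrees of the two parts have different parity, so
  their leading terms cannot cancel.\<close>

lemma degree_even_plus_odd:
  fixes u v :: "'a::idom poly"
  shows "Polynomial.degree (u \<circ>\<^sub>p [:0, 0, 1:] + [:0, 1:] * (v \<circ>\<^sub>p [:0, 0, 1:])) =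
    (if v = 0 then 2 * Polynomial.degree u
     else max (2 * Polynomial.degree u) (Suc (2 * Polynomial.degree v)))"
proof (cases "v = 0")
  case False
  let ?E = "u \<circ>\<^sub>p [:0, 0, 1:]" and ?O = "[:0, 1:] * (v \<circ>\<^sub>p [:0, 0, 1:])"
  have "v \<circ>\<^sub>p [:0, 0, 1:] \<noteq> 0"
    using False by (simp add: pcompose_eq_0_iff)
  then have dO: "Polynomial.degree ?O = Suc (2 * Polynomial.degree v)"
    by (simp add: degree_mult_eq degree_pcompose)
  have dE: "Polynomial.degree ?E = 2 * Polynomial.degree u"
    by (simp add: degree_pcompose)
  have "Polynomial.degree ?E \<noteq> Polynomial.degree ?O"
    unfolding dO dE by presburger
  then have "Polynomial.degree (?E + ?O) = max (Polynomial.degree ?E) (Polynomial.degree ?O)"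
    by (cases "Polynomial.degree ?E < Polynomial.degree ?O")
      (simp_all add: degree_add_eq_right degree_add_eq_left del: mult_pCons_left)
  then show ?thesis
    using False dO dE by simp
qed (simp add: degree_pcompose)

lemma even_plus_odd_eq_0D:
  fixes u v :: "'a::idom poly"
  assumes "u \<circ>\<^sub>p [:0, 0, 1:] + [:0, 1:] * (v \<circ>\<^sub>p [:0, 0, 1:]) = 0"
  shows "u = 0 \<and> v = 0"
proof -
  have v: "v = 0"
    using degree_even_plus_odd[of u v] assms by (simp split: if_splits del: mult_pCons_left)
  then show ?thesis
    using assms by (simp add: pcompose_eq_0_iff)
qed

text \<open>The expression \<open>u^2 - x v^2\<close> is the norm P(x) P(-x) of P = u(x^2) + x
  v(x^2), written in x instead of x^2. Its two terms have degrees of different parity if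
  \<open>v\<close> is nonzero, so one of them alone supplies the leading coefficient.\<close>

lemma norm_form:
  fixes u v :: "'a::idom poly"
  shows "Polynomial.degree (u * u - [:0, 1:] * (v * v)) =
      Polynomial.degree (u \<circ>\<^sub>p [:0, 0, 1:] + [:0, 1:] * (v \<circ>\<^sub>p [:0, 0, 1:]))"
    and "\<exists>e. Polynomial.lead_coeff (u * u - [:0, 1:] * (v * v)) = e ^ 2 \<or>
      Polynomial.lead_coeff (u * u - [:0, 1:] * (v * v)) = - (e ^ 2)"
proof -
  let ?E = "u * u" and ?O = "- ([:0, 1:] * (v * v))"
  have lE: "Polynomial.lead_coeff ?E = Polynomial.lead_coeff u ^ 2"
    by (simp only: lead_coeff_mult power2_eq_square)
  have "Polynomial.degree (?E + ?O) =
      Polynomial.degree (u \<circ>\<^sub>p [:0, 0, 1:] + [:0, 1:] * (v \<circ>\<^sub>p [:0, 0, 1:])) \<and>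
    (\<exists>e. Polynomial.lead_coeff (?E + ?O) = e ^ 2 \<or> Polynomial.lead_coeff (?E + ?O) = - (e ^ 2))"
  proof (cases "v = 0")
    case True
    have "Polynomial.degree (u * u) = 2 * Polynomial.degree u"
      by (cases "u = 0") (simp_all add: degree_mult_eq)
    then show ?thesis
      using True lE by (auto simp: degree_pcompose)
  next
    case False
    have dE: "Polynomial.degree ?E = 2 * Polynomial.degree u"
      by (cases "u = 0") (simp_all add: degree_mult_eq)
    have dO: "Polynomial.degree ?O = Suc (2 * Polynomial.degree v)"
      using False by (simp add: degree_mult_eq)
    have lO: "Polynomial.lead_coeff ?O = - (Polynomial.lead_coeff v ^ 2)"
      by (simp only: lead_coeff_minus lead_coeff_mult) (simp add: power2_eq_square)
    have "Polynomial.degree ?E \<noteq> Polynomial.degree ?O"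
      unfolding dE dO by presburger
    then consider "Polynomial.degree ?E < Polynomial.degree ?O" | "Polynomial.degree ?O < Polynomial.degree ?E"
      by linarith
    then show ?thesis
    proof cases
      case 1
      have "Polynomial.degree (?E + ?O) = Polynomial.degree ?O"
        "Polynomial.lead_coeff (?E + ?O) = Polynomial.lead_coeff ?O"
        by (rule degree_add_eq_right[OF 1], rule lead_coeff_add_le[OF 1])
      then have deg: "Polynomial.degree (?E + ?O) =
          Polynomial.degree (u \<circ>\<^sub>p [:0, 0, 1:] + [:0, 1:] * (v \<circ>\<^sub>p [:0, 0, 1:]))"
        and "Polynomial.lead_coeff (?E + ?O) = - (Polynomial.lead_coeff v ^ 2)"
        using 1 False dO dE lO unfolding degree_even_plus_odd by auto
      then show ?thesis by blast
    next
      case 2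
      have "Polynomial.degree (?E + ?O) = Polynomial.degree ?E"
        "Polynomial.lead_coeff (?E + ?O) = Polynomial.lead_coeff ?E"
        using degree_add_eq_left[OF 2] lead_coeff_add_le[OF 2] by (metis add.commute)+
      then have deg: "Polynomial.degree (?E + ?O) =
          Polynomial.degree (u \<circ>\<^sub>p [:0, 0, 1:] + [:0, 1:] * (v \<circ>\<^sub>p [:0, 0, 1:]))"
        and "Polynomial.lead_coeff (?E + ?O) = Polynomial.lead_coeff u ^ 2"
        using 2 False dO dE lE unfolding degree_even_plus_odd by auto
      then show ?thesis by blast
    qed
  qed
  then show "Polynomial.degree (u * u - [:0, 1:] * (v * v)) =
      Polynomial.degree (u \<circ>\<^sub>p [:0, 0, 1:] + [:0, 1:] * (v \<circ>\<^sub>p [:0, 0, 1:]))"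
    and "\<exists>e. Polynomial.lead_coeff (u * u - [:0, 1:] * (v * v)) = e ^ 2 \<or>
      Polynomial.lead_coeff (u * u - [:0, 1:] * (v * v)) = - (e ^ 2)"
    unfolding diff_conv_add_uminus by blast+
qed

text \<open>A nonzero element of least degree in the ideal generated by \<open>p\<close> and
  \<open>q\<close> divides both, by division with remainder. As \<open>p\<close> is irreducible and
  does not divide \<open>q\<close>, this common divisor is a unit.\<close>

lemma irreducible_bezout:
  fixes p :: "'a::field poly"
  assumes irr: "Factorial_Ring.irreducible p" and ndvd: "\<not> p dvd q"
  shows "\<exists>a b. a * p + b * q = 1"
proof -
  define I where "I = {g. g \<noteq> 0 \<and> (\<exists>a b. g = a * p + b * q)}"
  have "p \<in> I"
    using irr by (auto simp: I_def intro: exI[of _ 1] exI[of _ 0])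
  then obtain g where g: "g \<in> I" "\<And>h. h \<in> I \<Longrightarrow> Polynomial.degree g \<le> Polynomial.degree h"
    using ex_has_least_nat[of "\<lambda>h. h \<in> I" p Polynomial.degree] by blast
  then obtain a b where ab: "g = a * p + b * q" and "g \<noteq> 0"
    by (auto simp: I_def)
  have dvd: "g dvd f" if f: "f = c * p + d * q" for c d f
  proof (rule ccontr)
    assume "\<not> g dvd f"
    then have "f mod g \<noteq> 0" by (simp add: dvd_eq_mod_eq_0)
    moreover have "f mod g = (c - f div g * a) * p + (d - f div g * b) * q"
    proof -
      have "f mod g = f - f div g * g" by (simp add: minus_div_mult_eq_mod)
      moreover have "f - k * g = (c - k * a) * p + (d - k * b) * q" for k
        unfolding f ab by (simp add: algebra_simps)
      ultimately show ?thesis by simp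
    qed
    ultimately have "f mod g \<in> I" by (auto simp: I_def)
    then show False
      using g(2) degree_mod_less[OF \<open>g \<noteq> 0\<close>, of f] \<open>f mod g \<noteq> 0\<close> by fastforce
  qed
  have "g dvd p" "g dvd q"
    using dvd[of p 1 0] dvd[of q 0 1] by simp_all
  then obtain h where h: "p = g * h" by blast
  have "\<not> p dvd g"
    using \<open>g dvd q\<close> ndvd dvd_trans by blast
  then have "\<not> is_unit h"
    by (auto simp: h mult_unit_dvd_iff)
  then have "is_unit g"
    using irreducibleD[OF irr h] by blast
  then obtain e where "1 = g * e" by (elim dvdE)
  then have "e * a * p + e * b * q = 1"
    by (simp add: ab algebra_simps)
  then show ?thesis by blast
qed

lemma irreducible_dvd_mult:
  fixes p :: "'a::field poly"
  assumes irr: "Factorial_Ring.irreducible p" and "p dvd q * r" "\<not> p dvd q"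
  shows "p dvd r"
proof -
  obtain a b where ab: "a * p + b * q = 1" using irreducible_bezout[OF irr assms(3)] by blast
  have "r = (a * p + b * q) * r" by (simp only: ab mult_1_left)
  also have "\<dots> = p * (a * r) + b * (q * r)" by (simp add: algebra_simps)
  finally have r: "r = p * (a * r) + b * (q * r)" .
  have "p dvd p * (a * r) + b * (q * r)"
    by (rule dvd_add[OF dvd_triv_left dvd_mult[OF assms(2)]])
  then show ?thesis unfolding r[symmetric] .
qed

text \<open>A factor \<open>A(x\<^sup>2) + x B(x\<^sup>2)\<close> of \<open>h(x\<^sup>2)\<close> yields the factor \<open>A\<^sup>2 - x B\<^sup>2\<close> of \<open>h\<^sup>2\<close>, which for a
  nontrivial factorization has to be a scalar multiple of \<open>h\<close>; compare values at \<open>0\<close>.\<close>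

lemma irreducible_pcompose_square:
  fixes h :: "'a::field poly"
  assumes irr: "Factorial_Ring.irreducible h" and monic: "Polynomial.lead_coeff h = 1"
    and nsq: "\<And>s. s ^ 2 \<noteq> poly h 0" "\<And>s. s ^ 2 \<noteq> - poly h 0"
  shows "Factorial_Ring.irreducible (h \<circ>\<^sub>p [:0, 0, 1:])"
proof (rule irreducibleI)
  let ?S = "[:0, 0, 1::'a:]" and ?X = "[:0, 1::'a:]"
  let ?d = "Polynomial.degree :: 'a poly \<Rightarrow> nat"
  have "h \<noteq> 0" using irr by auto
  then show "h \<circ>\<^sub>p ?S \<noteq> 0" by (simp add: pcompose_eq_0_iff)
  have "?d h \<noteq> 0"
    using irr \<open>h \<noteq> 0\<close> by (metis irreducible_not_unit is_unit_iff_degree)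
  then show "\<not> is_unit (h \<circ>\<^sub>p ?S)"
    using \<open>h \<circ>\<^sub>p ?S \<noteq> 0\<close> by (simp add: is_unit_iff_degree degree_pcompose)
  fix P Q assume PQ: "h \<circ>\<^sub>p ?S = P * Q"
  obtain A B where P: "P = A \<circ>\<^sub>p ?S + ?X * (B \<circ>\<^sub>p ?S)" using poly_even_odd_parts by blast
  obtain C D where Q: "Q = C \<circ>\<^sub>p ?S + ?X * (D \<circ>\<^sub>p ?S)" using poly_even_odd_parts by blast
  have XS: "?X \<circ>\<^sub>p ?S = ?X * ?X" by (simp add: pcompose_pCons)
  have expand: "(a + x * b) * (c + x * d) = (a * c + x * x * (b * d)) + x * (a * d + b * c)"
    for a b c d x :: "'a poly" by (simp add: algebra_simps)
  \<comment> \<open>Both sides vanish, and the left one is already sorted into even and odd part, so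
    each part is zero.\<close>
  have "(A * C + ?X * (B * D) - h) \<circ>\<^sub>p ?S + ?X * ((A * D + B * C) \<circ>\<^sub>p ?S) = P * Q - h \<circ>\<^sub>p ?S"
    by (simp only: P Q pcompose_add pcompose_diff pcompose_mult XS expand diff_add_eq)
  then have "A * C + ?X * (B * D) - h = 0" and AD: "A * D + B * C = 0"
    using even_plus_odd_eq_0D[of "A * C + ?X * (B * D) - h" "A * D + B * C"] PQ by simp_all
  then have h: "h = A * C + ?X * (B * D)" by simp
  define U V where "U = A * A - ?X * (B * B)" and "V = C * C - ?X * (D * D)"
  \<comment> \<open>Multiplicativity of the norm. The subtracted term vanishes because the odd part
    AD + BC of PQ is zero, which leaves \<open>U * V = h * h\<close>.\<close>
  have norm: "(a * a - x * (b * b)) * (c * c - x * (d * d)) =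
      (a * c + x * (b * d)) * (a * c + x * (b * d)) - x * ((a * d + b * c) * (a * d + b * c))"
    for a b c d x :: "'a poly" by (simp add: algebra_simps)
  have "U * V = h * h - ?X * ((A * D + B * C) * (A * D + B * C))"
    unfolding U_def V_def h by (rule norm)
  then have UV: "U * V = h * h" using AD by simp
  have "U \<noteq> 0" "V \<noteq> 0" using UV \<open>h \<noteq> 0\<close> by auto
  \<comment> \<open>A factor has the same degree as its norm, so a constant norm comes from a
    constant factor.\<close>
  have unit: "is_unit (A' \<circ>\<^sub>p ?S + ?X * (B' \<circ>\<^sub>p ?S))"
    if "is_unit (A' * A' - ?X * (B' * B'))" for A' B' :: "'a poly"
  proof -
    have d: "?d (A' \<circ>\<^sub>p ?S + ?X * (B' \<circ>\<^sub>p ?S)) = 0"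
      using that norm_form(1)[of A' B'] by (metis is_unit_iff_degree not_is_unit_0)
    have "A' \<circ>\<^sub>p ?S + ?X * (B' \<circ>\<^sub>p ?S) \<noteq> 0"
      using even_plus_odd_eq_0D[of A' B'] that by (metis diff_0_right mult_zero_right not_is_unit_0)
    with d show ?thesis by (metis is_unit_iff_degree not_is_unit_0)
  qed
  show "is_unit P \<or> is_unit Q"
  proof (rule ccontr)
    assume "\<not> (is_unit P \<or> is_unit Q)"
    then have nu: "\<not> is_unit U" "\<not> is_unit V"
      using unit unfolding P Q U_def V_def by blast+
    \<comment> \<open>Otherwise h divides V, say V = hW, and cancelling h gives h = UW. Then W is a
      unit, so h divides U after all.\<close>
    have dvd: "h dvd U"
    proof (rule ccontr)
      assume "\<not> h dvd U"
      then have "h dvd V" using irreducible_dvd_mult[OF irr, of U V] UV by simp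
      then obtain W where "V = h * W" by blast
      then have "U * W = h" using UV \<open>h \<noteq> 0\<close> by (simp add: mult.left_commute)
      then have "h = U * W" by simp
      then have "is_unit W" using irreducibleD[OF irr, of U W] nu by blast
      then show False
        using \<open>\<not> h dvd U\<close> \<open>h = U * W\<close> by (auto simp: mult_unit_dvd_iff)
    qed
    then obtain W where W: "U = h * W" by blast
    have "W * V = h" using UV \<open>h \<noteq> 0\<close> by (simp add: W)
    then have "is_unit W" using irreducibleD[OF irr, of W V] nu by auto
    then obtain c where c: "W = [:c:]" by (auto simp: is_unit_poly_iff)
    then have "c \<noteq> 0" using W \<open>U \<noteq> 0\<close> by auto
    have U: "U = Polynomial.smult c h" by (simp add: W c)
    \<comment> \<open>At 0 the term with B drops out. As c is plus or minus a square, so is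
      h(0).\<close>
    have at0: "c * poly h 0 = poly A 0 ^ 2"
      using arg_cong[OF U, of "\<lambda>p. poly p 0"] by (simp add: U_def power2_eq_square)
    have "c = Polynomial.lead_coeff U" using monic by (simp add: U)
    moreover have "\<exists>e. Polynomial.lead_coeff U = e ^ 2 \<or> Polynomial.lead_coeff U = - (e ^ 2)"
      unfolding U_def by (rule norm_form(2))
    ultimately have "\<exists>e. c = e ^ 2 \<or> c = - (e ^ 2)" by simp
    then obtain e where "c = e ^ 2 \<or> c = - (e ^ 2)" by blast
    then have "(poly A 0 / e) ^ 2 = poly h 0 \<or> (poly A 0 / e) ^ 2 = - poly h 0"
      using at0 \<open>c \<noteq> 0\<close> by (auto simp: power_divide field_simps)
    then show False using nsq by blast
  qed
qed

lemma irreducible_pcompose_shift: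
  fixes p :: "'a::field poly"
  assumes irr: "Factorial_Ring.irreducible p"
  shows "Factorial_Ring.irreducible (p \<circ>\<^sub>p [:a, 1:])"
proof (rule irreducibleI)
  have inv: "q \<circ>\<^sub>p [:- a, 1:] \<circ>\<^sub>p [:a, 1:] = q" "q \<circ>\<^sub>p [:a, 1:] \<circ>\<^sub>p [:- a, 1:] = q" for q :: "'a poly"
    by (simp_all add: pcompose_assoc[symmetric] pcompose_pCons)
  have unit: "is_unit (q \<circ>\<^sub>p [:b, 1:])" if "is_unit q" for q :: "'a poly" and b
    using that by (auto simp: is_unit_poly_iff)
  show "p \<circ>\<^sub>p [:a, 1:] \<noteq> 0"
    using irr by (auto simp: pcompose_eq_0_iff)
  show "\<not> is_unit (p \<circ>\<^sub>p [:a, 1:])"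
    using unit[of "p \<circ>\<^sub>p [:a, 1:]" "- a"] irreducible_not_unit[OF irr] by (auto simp: inv)
  fix u v assume "p \<circ>\<^sub>p [:a, 1:] = u * v"
  then have "p = (u \<circ>\<^sub>p [:- a, 1:]) * (v \<circ>\<^sub>p [:- a, 1:])"
    by (metis inv(2) pcompose_mult)
  then have "is_unit (u \<circ>\<^sub>p [:- a, 1:]) \<or> is_unit (v \<circ>\<^sub>p [:- a, 1:])"
    using irreducibleD[OF irr] by blast
  then show "is_unit u \<or> is_unit v"
    using unit[of "u \<circ>\<^sub>p [:- a, 1:]" a] unit[of "v \<circ>\<^sub>p [:- a, 1:]" a] by (auto simp: inv)
qed

text \<open>Composing with \<open>x^2 + b\<close> means shifting by b and then substituting
  \<open>x^2\<close>. The shifted polynomial has constant term \<open>nest a (Suc m) 0\<close>,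
  which is what the criterion for \<open>x^2\<close> asks about. The induction starts at the
  polynomial x, so m = 0 is included.\<close>

theorem irreducible_comp_seq:
  fixes a :: "nat \<Rightarrow> 'a::field"
  assumes nsq: "\<And>m s. m \<ge> 1 \<Longrightarrow> s ^ 2 \<noteq> nest a m 0" "\<And>m s. m \<ge> 1 \<Longrightarrow> s ^ 2 \<noteq> - nest a m 0"
  shows "Factorial_Ring.irreducible (comp_seq (\<lambda>m. [:a m, 0, 1:]) m)"
proof (induction m)
  case 0
  show ?case
  proof (rule irreducibleI)
    fix u v :: "'a poly"
    assume uv: "comp_seq (\<lambda>m. [:a m, 0, 1:]) 0 = u * v"
    then have "u \<noteq> 0" "v \<noteq> 0" by auto
    moreover have "Polynomial.degree (u * v) = 1" using uv[symmetric] by simp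
    ultimately have "Polynomial.degree u + Polynomial.degree v = 1"
      by (simp add: degree_mult_eq)
    then show "is_unit u \<or> is_unit v"
      using \<open>u \<noteq> 0\<close> \<open>v \<noteq> 0\<close> by (auto simp: is_unit_iff_degree add_is_1)
  qed (simp_all add: is_unit_iff_degree)
next
  case (Suc m)
  let ?g = "comp_seq (\<lambda>m. [:a m, 0, 1:]) m" and ?b = "a (Suc m)"
  let ?h = "?g \<circ>\<^sub>p [:?b, 1:]"
  have "poly ?h 0 = nest a (Suc m) 0"
    by (simp add: poly_pcompose poly_comp_seq)
  moreover have "Polynomial.lead_coeff ?h = Polynomial.lead_coeff ?g"
    by (subst lead_coeff_comp) simp_all
  then have "Polynomial.lead_coeff ?h = 1"
    using monic_comp_seq[of a m] by metis
  ultimately have "Factorial_Ring.irreducible (?h \<circ>\<^sub>p [:0, 0, 1:])"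
    using irreducible_pcompose_shift[OF Suc.IH, of ?b] nsq[of "Suc m"]
    by (intro irreducible_pcompose_square) simp_all
  moreover have "?h \<circ>\<^sub>p [:0, 0, 1:] = comp_seq (\<lambda>m. [:a m, 0, 1:]) (Suc m)"
    by (simp add: pcompose_assoc[symmetric] pcompose_pCons)
  ultimately show ?case by simp
qed

section \<open>Reduction modulo 2 and nonsquares in Q(t)\<close>

lemma hom_on_red2: "hom_on UNIV red2"
  using hom_on_map_poly[OF hom_on_of_int] by (simp add: red2_def[abs_def])

lemma bit_of_int_eq_0_iff: "(of_int x :: bit) = 0 \<longleftrightarrow> even x"
proof
  assume "(of_int x :: bit) = 0"
  then show "even x"
    by (cases "even x") (auto elim!: oddE)
qed (auto elim!: evenE)

lemma red2_eq_0_iff: "red2 p = 0 \<longleftrightarrow> (\<exists>q. p = Polynomial.smult 2 q)"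
proof
  assume "red2 p = 0"
  then have "even (Polynomial.coeff p n)" for n
    by (metis bit_of_int_eq_0_iff coeff_0 coeff_map_poly of_int_0 red2_def)
  then have "p = Polynomial.smult 2 (map_poly (\<lambda>x. x div 2) p)"
    by (intro poly_eqI) (simp add: coeff_map_poly)
  then show "\<exists>q. p = Polynomial.smult 2 q" by blast
next
  assume "\<exists>q. p = Polynomial.smult 2 q"
  then show "red2 p = 0"
    by (auto intro!: poly_eqI simp: red2_def coeff_map_poly)
qed

lemma bit_poly_two [simp]: "(2 :: bit poly) = 0"
  by (simp add: numeral_poly)

lemma pderiv_bit_square: "pderiv (p ^ 2 :: bit poly) = 0"
  by (simp add: power2_eq_square pderiv_mult mult.commute)

lemma poly_smult_cancel:
  fixes p q :: "'a::idom poly"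
  assumes "c \<noteq> 0" "Polynomial.smult c p = Polynomial.smult c q"
  shows "p = q"
  using assms by (metis coeff_smult mult_left_cancel poly_eqI)

text \<open>Infinite descent. Modulo 2, differentiating \<open>F^2 = y G^2\<close> gives
  \<open>G^2 = 0\<close>, hence also \<open>F^2 = 0\<close>, so both polynomials can be halved. The
  leading coefficient of \<open>G\<close> shrinks in absolute value.\<close>

lemma int_poly_square_multiple:
  assumes y: "pderiv (red2 y) = 1" and eq: "F ^ 2 = y * G ^ 2"
  shows "G = 0"
proof (rule ccontr)
  assume "G \<noteq> 0"
  then show False
    using eq
  proof (induction "nat \<bar>Polynomial.lead_coeff G\<bar>" arbitrary: F G rule: less_induct)
    case less
    note hom = hom_onD(3)[OF hom_on_red2] power2_eq_square
    have eq2: "red2 F ^ 2 = red2 y * red2 G ^ 2"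
      using arg_cong[OF less.prems(2), of red2] by (simp add: hom)
    have "red2 G ^ 2 = 0"
      using arg_cong[OF eq2, of pderiv] by (simp add: pderiv_bit_square pderiv_mult y)
    then have "red2 G = 0" "red2 F = 0" using eq2 by simp_all
    then obtain F' G' where FG: "F = Polynomial.smult 2 F'" "G = Polynomial.smult 2 G'"
      by (auto simp: red2_eq_0_iff)
    have "Polynomial.smult 4 (F' ^ 2) = Polynomial.smult 4 (y * G' ^ 2)"
      using less.prems(2) by (simp add: FG power2_eq_square)
    then have "F' ^ 2 = y * G' ^ 2" by (rule poly_smult_cancel[rotated]) simp
    moreover have "G' \<noteq> 0" using less.prems(1) FG by simp
    moreover have "nat \<bar>Polynomial.lead_coeff G'\<bar> < nat \<bar>Polynomial.lead_coeff G\<bar>"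
      using \<open>G' \<noteq> 0\<close> by (simp add: FG abs_mult)
    ultimately show False using less.hyps by blast
  qed
qed

lemma rat_poly_clear_denominators:
  "\<exists>d P. d \<noteq> 0 \<and> Polynomial.smult (of_int d) p = (map_poly of_int P :: rat poly)"
proof (induction p)
  case 0
  show ?case by (rule exI[of _ 1], rule exI[of _ 0]) simp
next
  case (pCons c p)
  then obtain d P where d: "d \<noteq> 0" and P: "Polynomial.smult (of_int d) p = map_poly of_int P" by blast
  obtain u v where c: "c = of_int u / of_int v" and v: "v \<noteq> 0"
    by (metis Fract_of_int_quotient quotient_of_denom_pos' quotient_of_div surj_pair less_irrefl snd_conv)
  have "Polynomial.smult (of_int (v * d)) (pCons c p) = map_poly of_int (pCons (d * u) (Polynomial.smult v P))"
  proof -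
    have "map_poly of_int (Polynomial.smult v P) = Polynomial.smult (of_int v) (Polynomial.smult (of_int d) p)"
      unfolding P by (rule poly_eqI) (simp add: coeff_map_poly)
    then show ?thesis using v by (simp add: map_poly_pCons c)
  qed
  then show ?case using d v by (metis mult_eq_0_iff)
qed

lemma hom_on_Qt_of: "hom_on UNIV Qt_of"
proof -
  have "hom_on UNIV (\<lambda>x::rat poly. Fraction_Field.Fract x 1)"
    by (simp add: hom_on_def One_fract_def)
  from hom_on_comp[OF hom_on_map_poly[OF hom_on_of_int] _ this] show ?thesis
    by (simp add: Qt_of_def[abs_def] comp_def)
qed

lemma Qt_of_eq_iff: "Qt_of x = Qt_of y \<longleftrightarrow> x = y"
proof
  assume "Qt_of x = Qt_of y"
  then have "map_poly of_int x = (map_poly of_int y :: rat poly)"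
    by (simp add: Qt_of_def eq_fract)
  then show "x = y"
    by (metis coeff_map_poly of_int_0 of_int_eq_iff poly_eqI)
qed simp

lemma Qt_quotient: "\<exists>F G. G \<noteq> 0 \<and> q * Qt_of G = Qt_of F"
proof -
  obtain f g where q: "q = Fraction_Field.Fract f g" and g: "g \<noteq> 0"
    by (cases q) auto
  obtain d F where d: "d \<noteq> 0" and F: "Polynomial.smult (of_int d) f = map_poly of_int F"
    using rat_poly_clear_denominators by blast
  obtain e G where e: "e \<noteq> 0" and G: "Polynomial.smult (of_int e) g = map_poly of_int G"
    using rat_poly_clear_denominators by blast
  have sm: "map_poly of_int (Polynomial.smult k P) = Polynomial.smult (of_int k :: rat) (map_poly of_int P)" for k P
    by (rule poly_eqI) (simp add: coeff_map_poly)
  have "G \<noteq> 0" using G g e by auto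
  then have "Polynomial.smult d G \<noteq> 0" using d by simp
  moreover have "q * Qt_of (Polynomial.smult d G) = Qt_of (Polynomial.smult e F)"
    using g d e by (simp add: q Qt_of_def sm F[symmetric] G[symmetric] eq_fract mult.commute)
  ultimately show ?thesis by blast
qed

lemma Qt_of_not_square:
  assumes y: "pderiv (red2 y) = 1"
  shows "s ^ 2 \<noteq> Qt_of y"
proof
  assume s: "s ^ 2 = Qt_of y"
  obtain F G where G: "G \<noteq> 0" and FG: "s * Qt_of G = Qt_of F" using Qt_quotient by blast
  have "Qt_of (F ^ 2) = s ^ 2 * Qt_of (G ^ 2)"
    by (simp add: power2_eq_square hom_onD(3)[OF hom_on_Qt_of] FG[symmetric])
  then have "Qt_of (F ^ 2) = Qt_of (y * G ^ 2)"
    by (simp add: s hom_onD(3)[OF hom_on_Qt_of])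
  then show False
    using int_poly_square_multiple[OF y, of F G] G by (simp add: Qt_of_eq_iff)
qed

lemma pderiv_red2_uminus:
  assumes "pderiv (red2 y) = 1"
  shows "pderiv (red2 (- y)) = 1"
proof -
  have "red2 (- y) = - red2 y" using hom_on_uminus[OF hom_on_red2, of y] by simp
  moreover have "- (1 :: bit poly) = 1" by (simp add: one_pCons)
  ultimately show ?thesis using assms by (simp add: pderiv_minus)
qed

lemma pderiv_red2_nest:
  assumes "pderiv (red2 (a 1)) = 1" "m \<ge> 1"
  shows "pderiv (red2 (nest a m x)) = 1"
proof -
  obtain y where "nest a m x = y ^ 2 + a 1"
    using nest_Suc_outer[of a "m - 1" x] assms(2) by auto
  then show ?thesis
    using pderiv_bit_square[of "red2 y"] assms(1)
    by (simp add: hom_onD[OF hom_on_red2] pderiv_add power2_eq_square)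
qed

section \<open>A primitive simple zero\<close>

text \<open>The factor is the primitive part of an integer polynomial of least degree vanishing at
  \<open>z\<close>. Divisibility is obtained over the integers, not just over the rationals, so that
  it can be reduced modulo 2.\<close>

lemma int_poly_common_root_factor:
  fixes z :: "'a::field_char_0"
  assumes "f \<noteq> 0" "poly (map_poly of_int f) z = 0"
  shows "\<exists>g :: int poly. Polynomial.degree g \<noteq> 0 \<and>
    (\<forall>h. poly (map_poly of_int h) z = 0 \<longrightarrow> g dvd h)"
proof -
  note hom = hom_on_map_poly[OF hom_on_of_int]
  let ?ev = "\<lambda>f :: int poly. poly (map_poly of_int f) z"
  define I where "I = {f. f \<noteq> 0 \<and> ?ev f = 0}"
  obtain g where g: "g \<in> I" and min: "\<And>h. h \<in> I \<Longrightarrow> Polynomial.degree g \<le> Polynomial.degree h"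
    using ex_has_least_nat[of "\<lambda>h. h \<in> I" f Polynomial.degree] assms by (auto simp: I_def)
  have ev_mult: "?ev (p * q) = ?ev p * ?ev q" for p q
    by (simp add: hom_onD[OF hom])
  have ev_smult: "?ev (Polynomial.smult k p) = of_int k * ?ev p" for k p
    using ev_mult[of "[:k:]" p] by (simp add: map_poly_pCons)
  define p where "p = primitive_part g"
  have "g \<noteq> 0" "?ev g = 0" using g by (auto simp: I_def)
  have deg: "Polynomial.degree p = Polynomial.degree g" by (simp add: p_def)
  have "content g \<noteq> 0" using \<open>g \<noteq> 0\<close> by simp
  have evp: "?ev p = 0"
    using ev_smult[of "content g" p] \<open>?ev g = 0\<close> \<open>content g \<noteq> 0\<close> by (simp add: p_def)
  have "p \<noteq> 0" using \<open>g \<noteq> 0\<close> by (simp add: p_def)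
  have content: "content p = 1" using \<open>g \<noteq> 0\<close> by (simp add: p_def)
  have "p dvd h" if "?ev h = 0" for h
  proof -
    \<comment> \<open>Pseudo-division stays over the integers at the price of a multiplier
      \<open>a\<close>; minimality of the degree forces the remainder to vanish.\<close>
    obtain r where r: "r = pseudo_mod h p" by simp
    obtain a q where "a \<noteq> 0" and aq: "Polynomial.smult a h = p * q + r"
      and deg_r: "r = 0 \<or> Polynomial.degree r < Polynomial.degree p"
      using pseudo_mod[OF \<open>p \<noteq> 0\<close>, of h] unfolding r by blast
    have "?ev r = 0"
      using arg_cong[OF aq, of ?ev] that evp by (simp only: ev_smult ev_mult hom_onD[OF hom] UNIV_I poly_add) simp
    then have "r = 0"
      using min[of r] deg_r by (cases "r = 0") (auto simp: I_def deg)
    then have aq: "Polynomial.smult a h = p * q" using aq by simp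
    \<comment> \<open>Gauss's lemma: \<open>p\<close> is primitive, so \<open>a\<close> divides the
      content of \<open>q\<close> and can be cancelled.\<close>
    have "a dvd content (Polynomial.smult a h)" by (simp add: content_smult)
    then have "a dvd content q"
      unfolding aq by (simp add: content_mult content)
    then have "[:a:] dvd q" by (simp add: const_poly_dvd_iff_dvd_content)
    then obtain q' where "q = Polynomial.smult a q'" by (elim dvdE) simp
    then have "h = p * q'" using aq poly_smult_cancel[OF \<open>a \<noteq> 0\<close>, of h "p * q'"] by simp
    then show ?thesis by simp
  qed
  moreover have "Polynomial.degree p \<noteq> 0"
  proof
    assume "Polynomial.degree p = 0"
    then obtain c where "p = [:c:]" by (metis degree_eq_zeroE)
    then show False using evp \<open>p \<noteq> 0\<close> by (simp add: map_poly_pCons)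
  qed
  ultimately show ?thesis by blast
qed

text \<open>Since the leading coefficient is odd, a repeated factor over \<open>\<int>\<close> would survive
  reduction modulo 2.\<close>

lemma simple_roots_of_pderiv_red2:
  fixes z :: "'a::field_char_0"
  assumes odd: "odd (Polynomial.lead_coeff y)" and y: "pderiv (red2 y) = 1"
    and root: "poly (map_poly of_int y) z = 0"
  shows "poly (pderiv (map_poly of_int y)) z \<noteq> 0"
proof
  assume "poly (pderiv (map_poly of_int y)) z = 0"
  then have root': "poly (map_poly of_int (pderiv y)) z = 0"
    by (simp add: map_poly_pderiv_hom[OF hom_on_of_int])
  have "y \<noteq> 0" using odd by auto
  then obtain g :: "int poly" where "Polynomial.degree g \<noteq> 0" and dvd: "g dvd y" "g dvd pderiv y"
    using int_poly_common_root_factor[OF _ root] root root' by blast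
  have "odd (Polynomial.lead_coeff g)"
    using odd dvd(1) by (auto simp: lead_coeff_mult elim!: dvdE)
  then have "Polynomial.coeff (red2 g) (Polynomial.degree g) \<noteq> 0"
    by (simp add: red2_def coeff_map_poly bit_of_int_eq_0_iff)
  then have "Polynomial.degree g \<le> Polynomial.degree (red2 g)"
    by (rule le_degree)
  \<comment> \<open>The reduction of \<open>g\<close> divides the derivative 1 and is constant,
    although the odd leading coefficient keeps its degree positive.\<close>
  moreover have "red2 g dvd red2 (pderiv y)"
    using dvd(2) by (auto simp: hom_onD[OF hom_on_red2] elim!: dvdE)
  then have "red2 g dvd 1"
    using y by (simp add: red2_def map_poly_pderiv_hom[OF hom_on_of_int])
  then have "Polynomial.degree (red2 g) = 0"
    by (auto simp: is_unit_poly_iff)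
  ultimately show False using \<open>Polynomial.degree g \<noteq> 0\<close> by simp
qed

text \<open>All complex zeros of \<open>y\<close> are simple, so there are as many as its degree,
  which is more than \<open>P\<close> can have.\<close>

lemma exists_simple_root:
  fixes y P :: "int poly"
  assumes odd: "odd (Polynomial.lead_coeff y)" and y: "pderiv (red2 y) = 1"
    and P: "P \<noteq> 0" "Polynomial.degree P < Polynomial.degree y"
  shows "\<exists>z :: complex. poly (map_poly of_int y) z = 0 \<and> poly (pderiv (map_poly of_int y)) z \<noteq> 0 \<and>
    poly (map_poly of_int P) z \<noteq> 0"
proof -
  let ?y = "map_poly of_int y :: complex poly" and ?P = "map_poly of_int P :: complex poly"
  have deg: "Polynomial.degree (map_poly of_int p :: complex poly) = Polynomial.degree p" for p
    by (rule degree_map_poly) simp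
  have "?P \<noteq> 0" using P(1) by (metis coeff_map_poly leading_coeff_0_iff deg of_int_0 of_int_eq_0_iff)
  have "?y \<noteq> 0" using P(2) deg[of y] by auto
  have "rsquarefree ?y"
    unfolding rsquarefree_roots using simple_roots_of_pderiv_red2[OF odd y] by blast
  then have "?y = Polynomial.smult (Polynomial.lead_coeff ?y) (\<Prod>z | poly ?y z = 0. [:- z, 1:])"
    by (rule complex_poly_decompose_rsquarefree[symmetric])
  then have "Polynomial.degree ?y = Polynomial.degree (\<Prod>z | poly ?y z = 0. [:- z, 1:])"
    using \<open>?y \<noteq> 0\<close> by (metis degree_smult_eq leading_coeff_0_iff)
  also have "\<dots> = card {z. poly ?y z = 0}"
    by (subst degree_prod_eq_sum_degree) auto
  finally have "card {z. poly ?y z = 0} = Polynomial.degree y" by (simp add: deg)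
  moreover have "card {z. poly ?P z = 0} \<le> Polynomial.degree P"
    using card_poly_roots_bound[OF \<open>?P \<noteq> 0\<close>] by (simp add: deg)
  ultimately have "\<not> {z. poly ?y z = 0} \<subseteq> {z. poly ?P z = 0}"
    using card_mono[OF poly_roots_finite[OF \<open>?P \<noteq> 0\<close>], of "{z. poly ?y z = 0}"] P(2) by linarith
  then obtain z where "poly ?y z = 0" "poly ?P z \<noteq> 0" by blast
  then show ?thesis using simple_roots_of_pderiv_red2[OF odd y] by blast
qed

text \<open>The bound \<open>e\<close> for the argument is separate from \<open>d\<close> because it
  doubles with each squaring.\<close>

lemma degree_nest_le:
  fixes a :: "nat \<Rightarrow> 'a::idom poly"
  assumes a: "\<And>i. Polynomial.degree (a i) \<le> d" and "Polynomial.degree x \<le> e" "d \<le> e"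
  shows "Polynomial.degree (nest a m x) \<le> e * 2 ^ m"
  using assms(2,3)
proof (induction m arbitrary: x e)
  case (Suc m)
  have "Polynomial.degree (x ^ 2) \<le> 2 * e"
    using Suc.prems degree_power_le[of x 2] by simp
  then have "Polynomial.degree (x ^ 2 + a (Suc m)) \<le> 2 * e"
    using degree_add_le[of "x ^ 2" "2 * e" "a (Suc m)"] a[of "Suc m"] Suc.prems by simp
  then show ?case
    using Suc.IH[of "x ^ 2 + a (Suc m)" "2 * e"] Suc.prems by (simp add: ac_simps)
qed simp

text \<open>Since the degree of \<open>x\<close> is positive and at least \<open>d\<close>, the
  square dominates the added term at every level.\<close>

lemma lead_coeff_nest:
  fixes a :: "nat \<Rightarrow> 'a::idom poly"
  assumes a: "\<And>i. Polynomial.degree (a i) \<le> d" and "d \<le> Polynomial.degree x" "d \<ge> 1"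
  shows "Polynomial.degree (nest a m x) = Polynomial.degree x * 2 ^ m \<and>
    Polynomial.lead_coeff (nest a m x) = Polynomial.lead_coeff x ^ 2 ^ m"
  using assms(2)
proof (induction m arbitrary: x)
  case (Suc m)
  have "x \<noteq> 0" using Suc.prems assms(3) by auto
  then have deg: "Polynomial.degree (x ^ 2) = 2 * Polynomial.degree x"
    by (simp add: degree_power_eq)
  have "Polynomial.degree (a (Suc m)) < Polynomial.degree (x ^ 2)"
    using a[of "Suc m"] Suc.prems assms(3) unfolding deg by linarith
  then have d: "Polynomial.degree (x ^ 2 + a (Suc m)) = 2 * Polynomial.degree x"
    and l: "Polynomial.lead_coeff (x ^ 2 + a (Suc m)) = Polynomial.lead_coeff x ^ 2"
    using degree_add_eq_left[of "a (Suc m)" "x ^ 2"] lead_coeff_add_le[of "a (Suc m)" "x ^ 2"] deg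
      lead_coeff_power[of x 2] by (metis add.commute)+
  have "Polynomial.degree (nest a m (x ^ 2 + a (Suc m))) = Polynomial.degree (x ^ 2 + a (Suc m)) * 2 ^ m"
    and lc: "Polynomial.lead_coeff (nest a m (x ^ 2 + a (Suc m))) =
      Polynomial.lead_coeff (x ^ 2 + a (Suc m)) ^ 2 ^ m"
    using Suc.IH[of "x ^ 2 + a (Suc m)"] Suc.prems d by auto
  then have "Polynomial.degree (nest a (Suc m) x) = Polynomial.degree x * 2 ^ Suc m"
    by (simp add: d)
  moreover have "Polynomial.lead_coeff (nest a (Suc m) x) = Polynomial.lead_coeff x ^ 2 ^ Suc m"
    by (simp only: nest.simps lc l power_mult[symmetric] power_Suc)
  ultimately show ?case ..
qed simp

lemma exists_primitive_simple_root:
  fixes a :: "nat \<Rightarrow> int poly"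
  assumes a: "\<And>i. Polynomial.degree (a i) \<le> Polynomial.degree (a (Suc m))"
    and odd: "odd (Polynomial.lead_coeff (a (Suc m)))"
    and deriv: "pderiv (red2 (a 1)) = 1"
  shows "\<exists>z :: complex. poly (map_poly of_int (nest a (Suc m) 0)) z = 0 \<and>
    poly (pderiv (map_poly of_int (nest a (Suc m) 0))) z \<noteq> 0 \<and>
    (\<forall>i\<in>{1..m}. poly (map_poly of_int (nest a i 0)) z \<noteq> 0)"
proof -
  let ?d = "Polynomial.degree (a (Suc m))"
  \<comment> \<open>If the maximal degree were 0, then \<open>a 1\<close> would be constant and
    could not have derivative 1 modulo 2.\<close>
  have "?d \<ge> 1"
  proof (rule ccontr)
    assume "\<not> ?d \<ge> 1"
    then have "Polynomial.degree (a 1) = 0" using a[of 1] by simp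
    then have "pderiv (red2 (a 1)) = 0"
      using pderiv_eq_0_iff[of "a 1"] map_poly_pderiv_hom[OF hom_on_of_int, of "a 1", where 'b = bit]
      by (simp add: red2_def)
    then show False using deriv by simp
  qed
  define P where "P = (\<Prod>i\<in>{1..m}. nest a i 0)"
  have nz: "nest a i 0 \<noteq> 0" if "i \<in> {1..m}" for i
    using pderiv_red2_nest[of a i 0] deriv that by (auto simp: red2_def)
  then have "P \<noteq> 0" by (auto simp: P_def)
  \<comment> \<open>The geometric sum d (1 + 2 + ... + 2^(k-1)) = d (2^k - 1), stated without
    subtraction.\<close>
  have "Polynomial.degree (\<Prod>i\<in>{1..k}. nest a i 0) + ?d \<le> ?d * 2 ^ k" for k
  proof (induction k)
    case (Suc k)
    have "(\<Prod>i\<in>{1..Suc k}. nest a i 0) = (\<Prod>i\<in>{1..k}. nest a i 0) * nest a (Suc k) 0" by simp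
    \<comment> \<open>Starting one level in, at the argument \<open>a (Suc k)\<close> instead of 0,
      saves a factor 2 in the bound.\<close>
    moreover have "Polynomial.degree (nest a (Suc k) 0) \<le> ?d * 2 ^ k"
      using degree_nest_le[where a = a and d = ?d and x = "a (Suc k)" and e = ?d and m = k, OF a] a[of "Suc k"] by simp
    ultimately show ?case
      using Suc.IH degree_mult_le[of "\<Prod>i\<in>{1..k}. nest a i 0" "nest a (Suc k) 0"] by (simp add: algebra_simps)
  qed simp
  then have "Polynomial.degree P + ?d \<le> ?d * 2 ^ m" by (simp add: P_def)
  moreover have top: "Polynomial.degree (nest a (Suc m) 0) = ?d * 2 ^ m \<and>
      Polynomial.lead_coeff (nest a (Suc m) 0) = Polynomial.lead_coeff (a (Suc m)) ^ 2 ^ m"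
  proof -
    have "nest a (Suc m) 0 = nest a m (a (Suc m))" by simp
    then show ?thesis
      using lead_coeff_nest[where a = a and d = ?d and x = "a (Suc m)" and m = m, OF a] \<open>?d \<ge> 1\<close>
      by (metis order_refl)
  qed
  ultimately have "Polynomial.degree P < Polynomial.degree (nest a (Suc m) 0)"
    using \<open>?d \<ge> 1\<close> by linarith
  moreover have "odd (Polynomial.lead_coeff (nest a (Suc m) 0))"
    unfolding top[THEN conjunct2] using odd by simp
  moreover have "pderiv (red2 (nest a (Suc m) 0)) = 1"
    using pderiv_red2_nest[of a "Suc m" 0] deriv by simp
  ultimately obtain z :: complex where z: "poly (map_poly of_int (nest a (Suc m) 0)) z = 0"
      "poly (pderiv (map_poly of_int (nest a (Suc m) 0))) z \<noteq> 0" "poly (map_poly of_int P) z \<noteq> 0"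
    using exists_simple_root \<open>P \<noteq> 0\<close> by blast
  have "poly (map_poly of_int (nest a i 0)) z \<noteq> 0" if "i \<in> {1..m}" for i
  proof -
    have "P = nest a i 0 * (\<Prod>i\<in>{1..m} - {i}. nest a i 0)"
      unfolding P_def using that by (simp add: prod.remove)
    then show ?thesis
      using z(3) by (auto simp: hom_onD[OF hom_on_map_poly[OF hom_on_of_int]])
  qed
  then show ?thesis using z by blast
qed

section \<open>Extending field embeddings by square roots\<close>

abbreviation type_ring :: "'a::field ring" where "type_ring \<equiv> ring_of_type_algebra"

lemma type_ring_simps:
  "carrier (type_ring :: 'a::field ring) = UNIV" "monoid.mult (type_ring :: 'a ring) = (*)"
  "monoid.one (type_ring :: 'a ring) = 1" "ring.zero (type_ring :: 'a ring) = 0"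
  "add (type_ring :: 'a ring) = (+)"
  by (simp_all add: ring_of_type_algebra_def)

lemma type_ring_a_inv: "a_inv (type_ring :: 'a::field ring) x = - x"
proof -
  interpret field "type_ring :: 'a ring" by (rule field_from_type_algebra)
  have "add (type_ring :: 'a ring) x (- x) = ring.zero type_ring"
    by (simp add: type_ring_simps)
  then show ?thesis
    by (metis type_ring_simps(1) UNIV_I minus_equality minus_minus add.inv_comm)
qed

lemma type_ring_m_inv: "x \<noteq> 0 \<Longrightarrow> m_inv (type_ring :: 'a::field ring) x = inverse x"
proof -
  assume x: "x \<noteq> 0"
  interpret field "type_ring :: 'a ring" by (rule field_from_type_algebra)
  have "monoid.mult (type_ring :: 'a ring) x (inverse x) = monoid.one type_ring"
    using x by (simp add: type_ring_simps)
  then show ?thesis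
    by (metis type_ring_simps(1) UNIV_I comm_inv_char)
qed

text \<open>The convention \<open>inverse 0 = 0\<close> permits closure under inverses without
  excluding 0, and 0 itself arises as 1 + (- 1).\<close>

lemma subfield_type_ring_iff:
  "subfield S (type_ring :: 'a::field ring) \<longleftrightarrow>
    1 \<in> S \<and> (\<forall>x\<in>S. \<forall>y\<in>S. x + y \<in> S \<and> x * y \<in> S) \<and> (\<forall>x\<in>S. - x \<in> S \<and> inverse x \<in> S)"
  (is "_ \<longleftrightarrow> ?R")
proof
  interpret field "type_ring :: 'a ring" by (rule field_from_type_algebra)
  assume S: "subfield S type_ring"
  note sub = subfieldE(1)[OF S]
  have "inverse x \<in> S" if "x \<in> S" for x
    using that subfield_m_inv(1)[OF S, of x] type_ring_m_inv[of x]
    by (cases "x = 0") (auto simp: type_ring_simps)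
  then show ?R
    using subringE[OF sub] by (simp add: type_ring_simps type_ring_a_inv)
next
  interpret field "type_ring :: 'a ring" by (rule field_from_type_algebra)
  assume R: ?R
  have "subring S type_ring"
    using R by (intro subringI) (auto simp: type_ring_simps type_ring_a_inv)
  then show "subfield S type_ring"
    using R by (intro subfieldI') (auto simp: type_ring_simps type_ring_m_inv)
qed

lemma subfieldD:
  assumes "subfield S (type_ring :: 'a::field ring)"
  shows "1 \<in> S" "0 \<in> S" "x \<in> S \<Longrightarrow> y \<in> S \<Longrightarrow> x + y \<in> S" "x \<in> S \<Longrightarrow> y \<in> S \<Longrightarrow> x * y \<in> S"
    "x \<in> S \<Longrightarrow> - x \<in> S" "x \<in> S \<Longrightarrow> inverse x \<in> S"
    "x \<in> S \<Longrightarrow> y \<in> S \<Longrightarrow> x - y \<in> S" "x \<in> S \<Longrightarrow> y \<in> S \<Longrightarrow> x / y \<in> S"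
proof -
  note R = assms[unfolded subfield_type_ring_iff]
  show "1 \<in> S" "x \<in> S \<Longrightarrow> y \<in> S \<Longrightarrow> x + y \<in> S" "x \<in> S \<Longrightarrow> y \<in> S \<Longrightarrow> x * y \<in> S"
    "x \<in> S \<Longrightarrow> - x \<in> S" "x \<in> S \<Longrightarrow> inverse x \<in> S"
    using R by auto
  show "0 \<in> S" using R by (metis add.right_inverse)
  show "x \<in> S \<Longrightarrow> y \<in> S \<Longrightarrow> x - y \<in> S" using R by (metis diff_conv_add_uminus)
  show "x \<in> S \<Longrightarrow> y \<in> S \<Longrightarrow> x / y \<in> S" using R by (metis divide_inverse)
qed

text \<open>In general only the span of 1 and \<open>r\<close> over \<open>F\<close>; it is the
  field F(r) once \<open>r ^ 2\<close> lies in the subfield \<open>F\<close>.\<close>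

definition adjoin :: "'a::field set \<Rightarrow> 'a \<Rightarrow> 'a set" where
  "adjoin F r = {u + v * r | u v. u \<in> F \<and> v \<in> F}"

lemma adjoinI: "u \<in> F \<Longrightarrow> v \<in> F \<Longrightarrow> u + v * r \<in> adjoin F r"
  by (auto simp: adjoin_def)

lemma adjoin_superset:
  assumes "subfield F type_ring"
  shows "F \<subseteq> adjoin F r" "r \<in> adjoin F r"
  using adjoinI[of _ F 0 r] adjoinI[of 0 F 1 r] subfieldD(1,2)[OF assms] by auto

text \<open>Two different representations would exhibit \<open>r\<close> as a quotient of elements
  of \<open>F\<close>.\<close>

lemma adjoin_unique:
  assumes F: "subfield F type_ring" and r: "r \<notin> F"
    and uv: "u \<in> F" "v \<in> F" "u' \<in> F" "v' \<in> F" "u + v * r = u' + v' * r"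
  shows "u = u' \<and> v = v'"
proof -
  have eq: "(v - v') * r = u' - u"
    using uv(5) by (simp add: algebra_simps)
  have "v = v'"
  proof (rule ccontr)
    assume "v \<noteq> v'"
    then have "r = (u' - u) / (v - v')"
      using eq by (simp add: field_simps)
    then show False using r uv subfieldD[OF F] by metis
  qed
  then show ?thesis using uv(5) by simp
qed

lemma subfield_adjoin:
  assumes F: "subfield F type_ring" and sq: "r ^ 2 \<in> F"
  shows "subfield (adjoin F r) type_ring"
proof (cases "r \<in> F")
  case True
  have "adjoin F r = F"
    using adjoin_superset(1)[OF F, of r] subfieldD(3,4)[OF F] True by (auto simp: adjoin_def)
  then show ?thesis using F by simp
next
  case False
  note FD = subfieldD[OF F]
  have "x + y \<in> adjoin F r \<and> x * y \<in> adjoin F r" if x: "x \<in> adjoin F r" and y: "y \<in> adjoin F r" for x y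
  proof -
    obtain u v u' v' where x: "x = u + v * r" "u \<in> F" "v \<in> F" and y: "y = u' + v' * r" "u' \<in> F" "v' \<in> F"
      using x y by (auto simp: adjoin_def)
    have "x + y = (u + u') + (v + v') * r" "x * y = (u * u' + v * v' * r ^ 2) + (u * v' + v * u') * r"
      by (simp_all add: x y algebra_simps power2_eq_square)
    then show ?thesis using x y sq by (metis adjoinI FD(3,4))
  qed
  moreover have "- x \<in> adjoin F r \<and> inverse x \<in> adjoin F r" if x: "x \<in> adjoin F r" for x
  proof -
    obtain u v where x: "x = u + v * r" "u \<in> F" "v \<in> F"
      using x by (auto simp: adjoin_def)
    have "- x = (- u) + (- v) * r" by (simp add: x)
    moreover have "inverse x \<in> adjoin F r"
    proof (cases "x = 0")
      case True
      then show ?thesis using adjoin_superset(1)[OF F] FD(2) by auto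
    next
      case x0: False
      have "u - v * r \<noteq> 0"
      proof
        assume "u - v * r = 0"
        then have "u + (- v) * r = 0 + 0 * r" by simp
        then have "u = 0 \<and> v = 0"
          using adjoin_unique[OF F False, of u "- v" 0 0] FD x by simp
        then show False using x0 x by simp
      qed
      \<comment> \<open>The inverse is the conjugate \<open>u - v * r\<close> divided by the norm
        \<open>N\<close>, which lies in \<open>F\<close>.\<close>
      define N where "N = u * u - v * v * r ^ 2"
      have N: "N = x * (u - v * r)" by (simp add: N_def x algebra_simps power2_eq_square)
      then have "N \<noteq> 0" using x0 \<open>u - v * r \<noteq> 0\<close> by simp
      have "N \<in> F" unfolding N_def using x sq by (intro FD)
      have "inverse x = c / (x * c)" if "c \<noteq> 0" for c
        using that x0 by (simp add: field_simps)
      then have "inverse x = (u - v * r) / N"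
        using \<open>u - v * r \<noteq> 0\<close> unfolding N by blast
      also have "\<dots> = u / N + (- v / N) * r"
        by (simp add: diff_divide_distrib)
      finally show ?thesis using \<open>N \<in> F\<close> x by (metis adjoinI FD(5,8))
    qed
    ultimately show ?thesis using x by (metis adjoinI FD(5))
  qed
  ultimately show ?thesis
    using adjoin_superset(1)[OF F, of r] FD(1) by (auto simp: subfield_type_ring_iff)
qed

text \<open>For \<open>r\<close> outside \<open>F\<close>, send \<open>u + v * r\<close> to \<sigma>
  u + \<sigma> v * w. Uniqueness of the representation makes this well defined, and the equation for
  \<open>w ^ 2\<close> makes it multiplicative.\<close>

lemma hom_on_extend_sqrt:
  fixes \<sigma> :: "'a::field \<Rightarrow> 'b::field"
  assumes F: "subfield F type_ring" and \<sigma>: "hom_on F \<sigma>" and sq: "r ^ 2 \<in> F"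
    and w: "w ^ 2 = \<sigma> (r ^ 2)"
  shows "\<exists>F' \<sigma>'. subfield F' type_ring \<and> F \<subseteq> F' \<and> r \<in> F' \<and> hom_on F' \<sigma>' \<and> (\<forall>x\<in>F. \<sigma>' x = \<sigma> x)"
proof (cases "r \<in> F")
  case True
  then show ?thesis using F \<sigma> by blast
next
  case False
  note FD = subfieldD[OF F] and h = hom_onD[OF \<sigma>]
  define \<sigma>' where "\<sigma>' x = (let p = (THE p. fst p \<in> F \<and> snd p \<in> F \<and> x = fst p + snd p * r)
    in \<sigma> (fst p) + \<sigma> (snd p) * w)" for x
  have \<sigma>': "\<sigma>' (u + v * r) = \<sigma> u + \<sigma> v * w" if "u \<in> F" "v \<in> F" for u v
  proof -
    have "(THE p. fst p \<in> F \<and> snd p \<in> F \<and> u + v * r = fst p + snd p * r) = (u, v)"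
    proof (rule the_equality)
      fix p assume "fst p \<in> F \<and> snd p \<in> F \<and> u + v * r = fst p + snd p * r"
      then have "u = fst p \<and> v = snd p"
        using adjoin_unique[OF F False that, of "fst p" "snd p"] by blast
      then show "p = (u, v)" by (simp add: prod_eq_iff)
    qed (use that in simp)
    then show ?thesis by (simp add: \<sigma>'_def)
  qed
  have ext: "\<sigma>' x = \<sigma> x" if "x \<in> F" for x
    using \<sigma>'[OF that FD(2)] hom_on_zero[OF \<sigma> FD(2)] by simp
  have "\<sigma>' (x + y) = \<sigma>' x + \<sigma>' y \<and> \<sigma>' (x * y) = \<sigma>' x * \<sigma>' y"
    if x: "x \<in> adjoin F r" and y: "y \<in> adjoin F r" for x y
  proof -
    obtain u v u' v' where x: "x = u + v * r" "u \<in> F" "v \<in> F" and y: "y = u' + v' * r" "u' \<in> F" "v' \<in> F"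
      using x y by (auto simp: adjoin_def)
    have s: "x + y = (u + u') + (v + v') * r"
      and p: "x * y = (u * u' + v * v' * r ^ 2) + (u * v' + v * u') * r"
      by (simp_all add: x y algebra_simps power2_eq_square)
    have \<sigma>x: "\<sigma>' x = \<sigma> u + \<sigma> v * w" unfolding x(1) by (rule \<sigma>'[OF x(2,3)])
    have \<sigma>y: "\<sigma>' y = \<sigma> u' + \<sigma> v' * w" unfolding y(1) by (rule \<sigma>'[OF y(2,3)])
    have "\<sigma>' (x + y) = \<sigma> (u + u') + \<sigma> (v + v') * w"
      unfolding s using x y by (intro \<sigma>' FD)
    also have "\<dots> = \<sigma>' x + \<sigma>' y"
      unfolding \<sigma>x \<sigma>y using x(2,3) y(2,3) by (simp add: h algebra_simps)
    finally have 1: "\<sigma>' (x + y) = \<sigma>' x + \<sigma>' y" .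
    have "\<sigma>' (x * y) = \<sigma> (u * u' + v * v' * r ^ 2) + \<sigma> (u * v' + v * u') * w"
      unfolding p using x y sq by (intro \<sigma>' FD)
    also have "\<dots> = (\<sigma> u * \<sigma> u' + \<sigma> v * \<sigma> v' * w ^ 2) + (\<sigma> u * \<sigma> v' + \<sigma> v * \<sigma> u') * w"
      using x(2,3) y(2,3) sq by (simp add: h FD w)
    also have "\<dots> = \<sigma>' x * \<sigma>' y"
      unfolding \<sigma>x \<sigma>y by (simp add: algebra_simps power2_eq_square)
    finally show ?thesis using 1 by blast
  qed
  then have "hom_on (adjoin F r) \<sigma>'"
    using ext[OF FD(1)] h(1) by (simp add: hom_on_def)
  then show ?thesis
    using subfield_adjoin[OF F sq] adjoin_superset[OF F, of r] ext by blast
qed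

lemma hom_on_extend_sqrts:
  fixes \<sigma> :: "'a::field \<Rightarrow> 'b::field"
  assumes "finite R" and F: "subfield F type_ring" and \<sigma>: "hom_on F \<sigma>"
    and R: "\<And>r. r \<in> R \<Longrightarrow> r ^ 2 \<in> F \<and> (\<exists>w. w ^ 2 = \<sigma> (r ^ 2))"
  shows "\<exists>F' \<sigma>'. subfield F' type_ring \<and> F \<subseteq> F' \<and> R \<subseteq> F' \<and> hom_on F' \<sigma>' \<and> (\<forall>x\<in>F. \<sigma>' x = \<sigma> x)"
  using assms(1) R
proof (induction R)
  case empty
  then show ?case using F \<sigma> by blast
next
  case (insert r R)
  then obtain F1 \<sigma>1 where 1: "subfield F1 type_ring" "F \<subseteq> F1" "R \<subseteq> F1" "hom_on F1 \<sigma>1" "\<forall>x\<in>F. \<sigma>1 x = \<sigma> x"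
    by auto
  obtain w where w: "w ^ 2 = \<sigma> (r ^ 2)" and rF: "r ^ 2 \<in> F" using insert.prems[of r] by auto
  obtain F2 \<sigma>2 where 2: "subfield F2 type_ring" "F1 \<subseteq> F2" "r \<in> F2" "hom_on F2 \<sigma>2" "\<forall>x\<in>F1. \<sigma>2 x = \<sigma>1 x"
    using hom_on_extend_sqrt[OF 1(1,4), of r w] rF 1(2,5) w by auto
  show ?case
    by (rule exI[of _ F2], rule exI[of _ \<sigma>2]) (use 1 2 in auto)
qed

text \<open>The field is the image of evaluation at \<beta>, a copy of K[x]/(p), and \<sigma> sends
  the value of f at \<beta> to its value at \<open>s\<close>.\<close>

lemma hom_on_extend_root:
  fixes p :: "'a::field poly" and \<iota> :: "'a \<Rightarrow> 'b::field" and \<tau> :: "'a \<Rightarrow> 'c::field"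
  assumes irr: "Factorial_Ring.irreducible p" and \<iota>: "hom_on UNIV \<iota>" and \<tau>: "hom_on UNIV \<tau>"
    and \<beta>: "poly (map_poly \<iota> p) \<beta> = 0" and s: "poly (map_poly \<tau> p) s = 0"
  shows "\<exists>F \<sigma>. subfield F type_ring \<and> range \<iota> \<subseteq> F \<and> \<beta> \<in> F \<and> hom_on F \<sigma> \<and>
    (\<forall>x. \<sigma> (\<iota> x) = \<tau> x) \<and> \<sigma> \<beta> = s"
proof -
  note hi = hom_onD[OF hom_on_map_poly[OF \<iota>]] and ht = hom_onD[OF hom_on_map_poly[OF \<tau>]]
  have hi': "map_poly \<iota> (- f) = - map_poly \<iota> f" for f
    using hom_on_uminus[OF hom_on_map_poly[OF \<iota>], of f] by simp
  define ev where "ev f = poly (map_poly \<iota> f) \<beta>" for f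
  define et where "et f = poly (map_poly \<tau> f) s" for f
  have ev: "ev (f + g) = ev f + ev g" "ev (f * g) = ev f * ev g" "ev 1 = 1" "ev (- f) = - ev f" for f g
    by (simp_all add: ev_def hi hi')
  have et: "et (f + g) = et f + et g" "et (f * g) = et f * et g" "et 1 = 1" for f g
    by (simp_all add: et_def ht)
  have const: "ev [:x:] = \<iota> x" "et [:x:] = \<tau> x" "ev [:0, 1:] = \<beta>" "et [:0, 1:] = s" for x
    using hom_onD(1)[OF \<iota>] hom_on_zero[OF \<iota>] hom_onD(1)[OF \<tau>] hom_on_zero[OF \<tau>]
    by (simp_all add: ev_def et_def map_poly_pCons)
  have p0: "ev p = 0" "et p = 0" using \<beta> s by (simp_all add: ev_def et_def)
  \<comment> \<open>This serves twice: a polynomial vanishing at \<beta> is divisible by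
    \<open>p\<close>, and nonzero values at \<beta> have inverses in the image.\<close>
  have bez: "\<exists>b. ev f * ev b = 1" if "\<not> p dvd f" for f
  proof -
    obtain a b where "a * p + b * f = 1" using irreducible_bezout[OF irr \<open>\<not> p dvd f\<close>] by blast
    then have "ev a * ev p + ev b * ev f = 1" by (metis ev(1-3))
    then show ?thesis using p0 by (auto simp: mult.commute)
  qed
  have wd: "et f = et g" if "ev f = ev g" for f g
  proof -
    have "ev (f - g) = 0" using that ev(1)[of f "- g"] ev(4)[of g] by simp
    then have "p dvd f - g" using bez[of "f - g"] by auto
    then obtain q where "f = g + p * q" by (metis dvdE diff_add_cancel add.commute)
    then show ?thesis using p0 by (simp add: et)
  qed
  \<comment> \<open>Any polynomial representing x may be chosen, since \<open>wd\<close> makes the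
    value at \<open>s\<close> independent of it.\<close>
  define \<sigma> where "\<sigma> x = et (SOME f. ev f = x)" for x
  have \<sigma>: "\<sigma> (ev f) = et f" for f
    unfolding \<sigma>_def by (rule wd) (rule someI_ex, blast)
  have "subfield (range ev) type_ring"
    unfolding subfield_type_ring_iff
  proof (intro conjI ballI)
    show "1 \<in> range ev" by (metis ev(3) rangeI)
    fix x assume "x \<in> range ev"
    then obtain f where f: "x = ev f" by blast
    show "- x \<in> range ev" unfolding f by (metis ev(4) rangeI)
    show "inverse x \<in> range ev"
    proof (cases "p dvd f")
      case True
      then have "x = 0" using p0 f by (auto simp: ev)
      then show ?thesis by (metis p0(1) inverse_zero rangeI)
    next
      case False
      then show ?thesis using bez[of f] f inverse_unique by blast
    qed
    fix y assume "y \<in> range ev"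
    then show "x + y \<in> range ev" "x * y \<in> range ev" unfolding f by (metis ev(1,2) imageE rangeI)+
  qed
  moreover have "hom_on (range ev) \<sigma>"
    unfolding hom_on_def by (auto simp: ev(1,2)[symmetric] \<sigma> et) (metis ev(3) et(3) \<sigma>)
  moreover have "range \<iota> \<subseteq> range ev" "\<beta> \<in> range ev" by (metis const(1) image_subsetI rangeI, metis const(3) rangeI)
  moreover have "\<sigma> (\<iota> x) = \<tau> x" "\<sigma> \<beta> = s" for x by (metis \<sigma> const)+
  ultimately show ?thesis by blast
qed

section \<open>Laurent expansion at a point\<close>

lemma fract_hom_extend:
  fixes f :: "'a::idom \<Rightarrow> 'b::field"
  assumes f: "hom_on UNIV f" and inj: "\<And>x. f x = 0 \<Longrightarrow> x = 0"
  shows "\<exists>\<tau>. hom_on UNIV \<tau> \<and> (\<forall>x. \<tau> (Fraction_Field.Fract x 1) = f x)"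
proof -
  define \<tau> where "\<tau> q = (SOME y. \<exists>a b. b \<noteq> 0 \<and> q = Fraction_Field.Fract a b \<and> y = f a / f b)" for q
  have f0: "f b \<noteq> 0" if "b \<noteq> 0" for b using inj that by blast
  have \<tau>: "\<tau> (Fraction_Field.Fract a b) = f a / f b" if "b \<noteq> 0" for a b
    unfolding \<tau>_def
  proof (rule someI2_ex)
    fix y assume "\<exists>a' b'. b' \<noteq> 0 \<and> Fraction_Field.Fract a b = Fraction_Field.Fract a' b' \<and> y = f a' / f b'"
    then obtain a' b' where *: "b' \<noteq> 0" "Fraction_Field.Fract a b = Fraction_Field.Fract a' b'" "y = f a' / f b'"
      by blast
    have "f (a' * b) = f (a * b')" using * that by (simp add: eq_fract)
    then show "y = f a / f b"
      using * that f0 by (simp add: hom_onD(3)[OF f] frac_eq_eq)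
  qed (use that in blast)
  have "\<tau> (x + y) = \<tau> x + \<tau> y \<and> \<tau> (x * y) = \<tau> x * \<tau> y" for x y
  proof (cases x, cases y)
    fix a b c d assume "x = Fraction_Field.Fract a b" "b \<noteq> 0" "y = Fraction_Field.Fract c d" "d \<noteq> 0"
    then show ?thesis
      using f0 by (simp add: \<tau> hom_onD[OF f] field_simps)
  qed
  moreover have "\<tau> 1 = 1"
    using \<tau>[of 1 1] hom_onD(1)[OF f] by (simp add: One_fract_def)
  moreover have "\<tau> (Fraction_Field.Fract x 1) = f x" for x
    using \<tau>[of 1 x] hom_onD(1)[OF f] by simp
  ultimately show ?thesis
    unfolding hom_on_def by blast
qed

text \<open>The Taylor expansion at t = z: the substitution puts z + X for t, so X stands for t -
  z.\<close>

definition expansion :: "complex \<Rightarrow> int poly \<Rightarrow> complex fps" where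
  "expansion z c = fps_of_poly (map_poly of_int c \<circ>\<^sub>p [:z, 1:])"

lemma hom_on_expansion: "hom_on UNIV (expansion z)"
  by (simp add: hom_on_def expansion_def fps_of_poly_add fps_of_poly_mult pcompose_add pcompose_mult
      hom_onD[OF hom_on_map_poly[OF hom_on_of_int]] pcompose_1)

lemma expansion_nth_0: "expansion z c $ 0 = poly (map_poly of_int c) z"
  by (simp add: expansion_def poly_0_coeff_0[symmetric] poly_pcompose)

lemma expansion_nth_1: "expansion z c $ 1 = poly (pderiv (map_poly of_int c)) z"
proof -
  have "expansion z c $ 1 = poly (pderiv (map_poly of_int c \<circ>\<^sub>p [:z, 1:])) 0"
    by (simp add: expansion_def poly_0_coeff_0 coeff_pderiv)
  then show ?thesis by (simp add: pderiv_pcompose poly_pcompose pderiv_pCons)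
qed

text \<open>The substitution z + X for t kills no nonzero polynomial, even if \<open>z\<close> is
  algebraic. So the expansion is injective on Q[t] and extends to the fraction field.\<close>

lemma Qt_laurent_expansion:
  fixes z :: complex
  shows "\<exists>\<tau> :: Qt \<Rightarrow> complex fls. hom_on UNIV \<tau> \<and> (\<forall>c. \<tau> (Qt_of c) = fps_to_fls (expansion z c))"
proof -
  define f :: "rat poly \<Rightarrow> complex fls"
    where "f p = fps_to_fls (fps_of_poly (map_poly of_rat p \<circ>\<^sub>p [:z, 1:]))" for p
  have "hom_on UNIV f"
    by (simp add: hom_on_def f_def fps_of_poly_add fps_of_poly_mult pcompose_add pcompose_mult
      hom_onD[OF hom_on_map_poly[OF hom_on_of_rat]] pcompose_1 fls_times_fps_to_fls)
  moreover have "x = 0" if "f x = 0" for x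
  proof -
    have "map_poly of_rat x \<circ>\<^sub>p [:z, 1:] = 0"
      using that fps_of_poly_eq_iff[of _ 0] by (simp add: f_def)
    then have "map_poly of_rat x = (0 :: complex poly)" by (simp add: pcompose_eq_0_iff)
    then show ?thesis by (metis coeff_map_poly coeff_0 of_rat_0 of_rat_eq_0_iff poly_eqI)
  qed
  ultimately obtain \<tau> where \<tau>: "hom_on UNIV \<tau>" "\<And>x. \<tau> (Fraction_Field.Fract x 1) = f x"
    using fract_hom_extend[of f] by blast
  have "map_poly of_rat (map_poly of_int c :: rat poly) = (map_poly of_int c :: complex poly)" for c
    by (rule poly_eqI) (simp add: coeff_map_poly)
  then have "\<tau> (Qt_of c) = fps_to_fls (expansion z c)" for c
    by (simp add: Qt_of_def \<tau>(2) f_def expansion_def)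
  then show ?thesis using \<tau>(1) by blast
qed

lemma fls_sqrt_of_unit:
  fixes s :: "complex fps"
  assumes "s $ 0 \<noteq> 0"
  shows "\<exists>w. w ^ 2 = fps_to_fls s"
proof -
  have "fps_radical (\<lambda>_. csqrt) (Suc 1) s ^ Suc 1 = s"
    by (subst power_radical[OF assms, symmetric]) (simp only: Suc_1 power2_csqrt)
  then have "fps_to_fls (fps_radical (\<lambda>_. csqrt) (Suc 1) s) ^ 2 = fps_to_fls s"
    by (metis Suc_1 fps_to_fls_power)
  then show ?thesis by blast
qed

text \<open>Squaring doubles the valuation, so a negative valuation would remain negative.\<close>

lemma fls_integral_of_square:
  fixes z :: "'a::field fls"
  assumes "z ^ 2 = fps_to_fls t"
  shows "\<exists>s. z = fps_to_fls s"
proof -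
  have "2 * fls_subdegree z \<ge> 0"
    using fls_subdegree_pow[of z 2] fls_subdegree_fls_to_fps_gt0[of t] assms by simp
  then have "z = fps_to_fls (fls_regpart z)"
    by simp
  then show ?thesis by blast
qed

text \<open>An instance of power series being integrally closed, obtained by undoing one squaring at
  a time.\<close>

lemma nest_integral:
  fixes v :: "nat \<Rightarrow> 'a::field fps"
  assumes "nest (\<lambda>i. fps_to_fls (v i)) m z = fps_to_fls t"
  shows "\<exists>s. z = fps_to_fls s"
  using assms
proof (induction m arbitrary: z)
  case (Suc m)
  then obtain s where "z ^ 2 + fps_to_fls (v (Suc m)) = fps_to_fls s" by auto
  then have "z ^ 2 = fps_to_fls (s - v (Suc m))" by (simp add: algebra_simps)
  then show ?case by (rule fls_integral_of_square)
qed auto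

lemma hom_on_fps_to_fls: "hom_on UNIV (fps_to_fls :: 'a::comm_ring_1 fps \<Rightarrow> 'a fls)"
  by (simp add: hom_on_def fls_times_fps_to_fls)

lemma hom_on_fps_nth_0: "hom_on UNIV (\<lambda>s :: 'a::comm_ring_1 fps. s $ 0)"
  by (simp add: hom_on_def)

text \<open>The constant term of \<open>z\<close> is a zero of the specialised \<gamma>_m. That of
  \<open>v (Suc m)\<close> is not, because \<gamma>_(m+1)(0) does not vanish at the centre. So the
  difference is a unit.\<close>

lemma fls_sqrt_of_root_diff:
  fixes v :: "nat \<Rightarrow> complex fps"
  assumes z: "nest (\<lambda>i. fps_to_fls (v i)) m z = 0" and nz: "nest v (Suc m) 0 $ 0 \<noteq> 0"
  shows "\<exists>w. w ^ 2 = z - fps_to_fls (v (Suc m))"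
proof -
  obtain s where s: "z = fps_to_fls s" using nest_integral[of v m z 0] z by auto
  have "nest v m s = 0"
    using z nest_hom[OF hom_on_fps_to_fls, of v m s] by (simp add: s)
  then have "nest (\<lambda>i. v i $ 0) m (s $ 0) = 0"
    using nest_hom[OF hom_on_fps_nth_0, of v m s] by simp
  moreover have "nest (\<lambda>i. v i $ 0) m (v (Suc m) $ 0) \<noteq> 0"
    using nz nest_hom[OF hom_on_fps_nth_0, of v m "v (Suc m)"] by simp
  ultimately have "(s - v (Suc m)) $ 0 \<noteq> 0" by auto
  then show ?thesis using fls_sqrt_of_unit[of "s - v (Suc m)"] by (simp add: s)
qed

section \<open>Independence of the square roots\<close>

lemma generate_field_type_ring:
  "subfield (generate_field (type_ring :: 'a::field ring) H) type_ring"
  "H \<subseteq> generate_field type_ring H"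
  "subfield E (type_ring :: 'a ring) \<Longrightarrow> H \<subseteq> E \<Longrightarrow> generate_field type_ring H \<subseteq> E"
proof -
  interpret field "type_ring :: 'a ring" by (rule field_from_type_algebra)
  show "subfield (generate_field (type_ring :: 'a ring) H) type_ring"
    by (rule generate_field_is_subfield) (simp add: type_ring_simps)
  show "H \<subseteq> generate_field type_ring H" by (auto intro: generate_field.incl)
  show "subfield E (type_ring :: 'a ring) \<Longrightarrow> H \<subseteq> E \<Longrightarrow> generate_field type_ring H \<subseteq> E"
    by (rule generate_field_min_subfield1) (simp_all add: type_ring_simps)
qed

lemma dimension_adjoin:
  fixes F :: "'a::field set"
  assumes F: "subfield F type_ring" and sq: "r ^ 2 \<in> F" and r: "r \<notin> F"
  shows "ring.dimension type_ring 2 F (adjoin F r)"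
proof -
  interpret field "type_ring :: 'a ring" by (rule field_from_type_algebra)
  have "dimension (Suc 1) F (line_extension F r F)"
    using dimension_one[OF F] r by (intro Suc_dim) (simp_all add: type_ring_simps)
  moreover have "line_extension F r F = adjoin F r"
    by (rule Set.set_eqI) (auto simp: line_extension_mem_iff adjoin_def type_ring_simps add.commute)
  ultimately show ?thesis by (simp add: numeral_2_eq_2)
qed

lemma dimension_mult:
  fixes F :: "'a::field set"
  assumes "subfield E type_ring" "subfield F type_ring"
    "ring.dimension type_ring m E F" "ring.dimension type_ring k F L"
  shows "ring.dimension type_ring (m * k) E L"
proof -
  interpret field "type_ring :: 'a ring" by (rule field_from_type_algebra)
  show ?thesis using telescopic_base assms by blast
qed

lemma generate_field_insert:
  fixes H :: "'a::field set"
  assumes "r ^ 2 \<in> generate_field type_ring H"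
  shows "generate_field type_ring (insert r H) = adjoin (generate_field type_ring H) r"
proof
  note G = generate_field_type_ring
  have sub: "subfield (adjoin (generate_field type_ring H) r) type_ring"
    by (rule subfield_adjoin[OF G(1) assms])
  show "generate_field type_ring (insert r H) \<subseteq> adjoin (generate_field type_ring H) r"
    using adjoin_superset[OF G(1)[of H], of r] G(2)[of H] by (intro G(3)[OF sub]) auto
  have "generate_field type_ring H \<subseteq> generate_field type_ring (insert r H)"
    using G(2)[of "insert r H"] by (intro G(3)[OF G(1)]) auto
  then show "adjoin (generate_field type_ring H) r \<subseteq> generate_field type_ring (insert r H)"
    using G(2)[of "insert r H"] by (auto simp: adjoin_def intro!: subfieldD(3,4)[OF G(1)])
qed

text \<open>Each new square root doubles the degree. Independence is assumed relative to all subsets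
  \<open>T\<close>, so that it is inherited when the induction removes an element of
  \<open>S\<close>.\<close>

lemma dimension_adjoin_sqrts:
  fixes H :: "'a::field set"
  assumes "finite S"
    and sq: "\<And>x. x \<in> S \<Longrightarrow> \<rho> x ^ 2 \<in> generate_field type_ring H"
    and indep: "\<And>x T. x \<in> S \<Longrightarrow> T \<subseteq> S - {x} \<Longrightarrow> \<rho> x \<notin> generate_field type_ring (H \<union> \<rho> ` T)"
  shows "ring.dimension type_ring (2 ^ card S) (generate_field type_ring H) (generate_field type_ring (H \<union> \<rho> ` S))"
  using assms
proof (induction S)
  case empty
  interpret field "type_ring :: 'a ring" by (rule field_from_type_algebra)
  show ?case using dimension_one[OF generate_field_type_ring(1)] by simp
next
  case (insert x S)
  note G = generate_field_type_ring
  let ?L = "generate_field type_ring (H \<union> \<rho> ` S)"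
  have "generate_field type_ring H \<subseteq> ?L"
    using G(2)[of "H \<union> \<rho> ` S"] by (intro G(3)[OF G(1)]) auto
  then have sq: "\<rho> x ^ 2 \<in> ?L" using insert.prems(1)[of x] by auto
  have "\<rho> x \<notin> ?L" using insert.hyps insert.prems(2)[of x S] by auto
  then have "ring.dimension type_ring 2 ?L (adjoin ?L (\<rho> x))"
    by (rule dimension_adjoin[OF G(1) sq])
  moreover have "ring.dimension type_ring (2 ^ card S) (generate_field type_ring H) ?L"
  proof (rule insert.IH)
    show "\<rho> y ^ 2 \<in> generate_field type_ring H" if "y \<in> S" for y using insert.prems(1) that by simp
    show "\<rho> y \<notin> generate_field type_ring (H \<union> \<rho> ` T)" if "y \<in> S" "T \<subseteq> S - {y}" for y T
      using insert.prems(2)[of y T] that by auto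
  qed
  ultimately have "ring.dimension type_ring (2 ^ card S * 2) (generate_field type_ring H) (adjoin ?L (\<rho> x))"
    by (intro dimension_mult[OF G(1) G(1)])
  moreover have "adjoin ?L (\<rho> x) = generate_field type_ring (H \<union> \<rho> ` insert x S)"
    using generate_field_insert[OF sq] by simp
  ultimately show ?case using insert.hyps by (simp add: mult.commute)
qed

lemma subfield_range_to_ac: "subfield (range (to_ac :: 'a::field \<Rightarrow> _)) type_ring"
  unfolding subfield_type_ring_iff
proof (intro conjI ballI)
  show "1 \<in> range (to_ac :: 'a \<Rightarrow> _)" by (metis to_ac_1 rangeI)
next
  fix x y :: "'a alg_closure" assume "x \<in> range to_ac" "y \<in> range to_ac"
  then obtain u w where xy: "x = to_ac u" "y = to_ac w" by blast
  show "x + y \<in> range to_ac" unfolding xy to_ac_add[symmetric] by (rule rangeI)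
  show "x * y \<in> range to_ac" unfolding xy to_ac_mult[symmetric] by (rule rangeI)
next
  fix x :: "'a alg_closure" assume "x \<in> range to_ac"
  then obtain u where x: "x = to_ac u" by blast
  show "- x \<in> range to_ac" unfolding x to_ac_minus[symmetric] by (rule rangeI)
  show "inverse x \<in> range to_ac" unfolding x to_ac_inverse[symmetric] by (rule rangeI)
qed

text \<open>A multiset of roots is used because their distinctness is only shown in
  \<open>card_roots\<close>.\<close>

lemma nest_factorization:
  fixes a :: "nat \<Rightarrow> 'a::alg_closed_field"
  shows "\<exists>M. size M = 2 ^ m \<and> (\<forall>y. nest a m y = (\<Prod>x\<in>#M. y - x))"
proof -
  let ?p = "comp_seq (\<lambda>m. [:a m, 0, 1:]) m"
  have "?p \<noteq> 0" "Polynomial.lead_coeff ?p = 1" "Polynomial.degree ?p = 2 ^ m"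
    using monic_comp_seq[of a m] by auto
  then obtain M where M: "size M = 2 ^ m" "?p = (\<Prod>x\<in>#M. [:- x, 1:])"
    using alg_closed_imp_factorization[of ?p] by (metis smult_1_left)
  have "nest a m y = (\<Prod>x\<in>#M. y - x)" for y
    using poly_comp_seq[of a m y] by (simp add: M(2) poly_prod_mset image_mset.compositionality comp_def)
  then show ?thesis using M(1) by blast
qed

lemma finite_nest_roots:
  fixes a :: "nat \<Rightarrow> 'a::idom"
  shows "finite {z. nest a m z = 0}"
proof -
  have "comp_seq (\<lambda>m. [:a m, 0, 1:]) m \<noteq> 0" using monic_comp_seq[of a m] by auto
  from poly_roots_finite[OF this] show ?thesis by (simp add: poly_comp_seq)
qed

lemma hom_on_prod_diff:
  fixes h :: "'a::field \<Rightarrow> 'b::field"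
  assumes h: "hom_on F h" and F: "subfield F type_ring" and "y \<in> F" "set_mset M \<subseteq> F"
  shows "(\<Prod>x\<in>#M. y - x) \<in> F \<and> h (\<Prod>x\<in>#M. y - x) = (\<Prod>x\<in>#M. h y - h x)"
  using assms(4)
proof (induction M)
  case (add x M)
  then show ?case
    using subfieldD[OF F] \<open>y \<in> F\<close> hom_on_diff[OF h subfieldD(2)[OF F]]
    by (simp add: hom_onD(3)[OF h])
qed (use subfieldD(1)[OF F] hom_onD(1)[OF h] in simp)

lemma fps_to_fls_prod_mset:
  "fps_to_fls (\<Prod>x\<in>#M. t x :: 'a::comm_ring_1 fps) = (\<Prod>x\<in>#M. fps_to_fls (t x))"
  by (induction M) (simp_all add: fls_times_fps_to_fls)

lemma fps_prod_mset_nth_0: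
  "(\<Prod>x\<in>#M. t x :: 'a::comm_ring_1 fps) $ 0 = (\<Prod>x\<in>#M. t x $ 0)"
  by (induction M) simp_all

text \<open>Here \<tau> plays the role of expansion at the chosen zero, with \<mu> = n - 1. Constant
  terms are values at the centre: \<gamma>_i(0) is a unit for 1 \<le> i \<le> \<mu>, while
  \<gamma>_(\<mu>+1)(0) has valuation exactly 1.\<close>

locale laurent_point =
  fixes a :: "nat \<Rightarrow> 'k::field" and \<tau> :: "'k \<Rightarrow> complex fls" and v :: "nat \<Rightarrow> complex fps" and \<mu> :: nat
  assumes \<tau>: "hom_on UNIV \<tau>" and v: "\<tau> (a i) = fps_to_fls (v i)"
    and unramified: "i \<in> {1..\<mu>} \<Longrightarrow> nest v i 0 $ 0 \<noteq> 0"
    and zero: "nest v (Suc \<mu>) 0 $ 0 = 0" and simple: "nest v (Suc \<mu>) 0 $ 1 \<noteq> 0"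
    and irr: "Factorial_Ring.irreducible (comp_seq (\<lambda>m. [:a m, 0, 1:]) \<mu>)"
begin

abbreviation A :: "nat \<Rightarrow> 'k alg_closure" where "A i \<equiv> to_ac (a i)"

definition embedding :: "'k alg_closure set \<Rightarrow> ('k alg_closure \<Rightarrow> complex fls) \<Rightarrow> bool" where
  "embedding F \<sigma> \<longleftrightarrow> subfield F type_ring \<and> range to_ac \<subseteq> F \<and> hom_on F \<sigma> \<and> (\<forall>x. \<sigma> (to_ac x) = \<tau> x)"

lemma embedding_nest:
  assumes "embedding F \<sigma>" "x \<in> F"
  shows "\<sigma> (nest A m x) = nest (\<lambda>i. fps_to_fls (v i)) m (\<sigma> x)"
proof -
  have "A i \<in> F" for i using assms(1) by (auto simp: embedding_def)
  then show ?thesis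
    using nest_hom_on[of F \<sigma> A x m] assms subfieldD(3,4)[of F] by (simp add: embedding_def v)
qed

lemma embedding_root:
  assumes "embedding F \<sigma>" "x \<in> F" "nest A m x = 0"
  shows "nest (\<lambda>i. fps_to_fls (v i)) m (\<sigma> x) = 0"
  using embedding_nest[OF assms(1,2), of m] assms subfieldD(2)[of F] hom_on_zero[of F \<sigma>]
  by (simp add: embedding_def)

text \<open>Induction over the levels. The roots of \<gamma>_(m+1) are square roots of differences
  of roots of \<gamma>_m and \<open>A (Suc m)\<close>, whose images have square roots by
  \<open>fls_sqrt_of_root_diff\<close>. At level 0 the only root is 0.\<close>

lemma embedding_extend_roots:
  assumes "embedding F \<sigma>" "m \<le> \<mu>"
  shows "\<exists>F' \<sigma>'. embedding F' \<sigma>' \<and> F \<subseteq> F' \<and> {z. nest A m z = 0} \<subseteq> F' \<and> (\<forall>x\<in>F. \<sigma>' x = \<sigma> x)"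
  using assms(2)
proof (induction m)
  case 0
  then show ?case using assms(1) subfieldD(2)[of F] by (auto simp: embedding_def intro!: exI[of _ F] exI[of _ \<sigma>])
next
  case (Suc m)
  then obtain F1 \<sigma>1 where 1: "embedding F1 \<sigma>1" "F \<subseteq> F1" "{z. nest A m z = 0} \<subseteq> F1" "\<forall>x\<in>F. \<sigma>1 x = \<sigma> x"
    by auto
  note sub = 1(1)[unfolded embedding_def]
  let ?R = "{z. nest A (Suc m) z = 0}"
  have "r ^ 2 \<in> F1 \<and> (\<exists>w. w ^ 2 = \<sigma>1 (r ^ 2))" if "r \<in> ?R" for r
  proof -
    define \<beta> where "\<beta> = r ^ 2 + A (Suc m)"
    have "nest A m \<beta> = 0" using that by (simp add: \<beta>_def)
    then have "\<beta> \<in> F1" using 1(3) by auto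
    have r: "r ^ 2 = \<beta> - A (Suc m)" by (simp add: \<beta>_def)
    have "A (Suc m) \<in> F1" using sub by auto
    then have "\<sigma>1 (r ^ 2) = \<sigma>1 \<beta> - fps_to_fls (v (Suc m))"
      unfolding r using sub \<open>\<beta> \<in> F1\<close> subfieldD(2,5)[of F1] hom_on_diff[of F1 \<sigma>1 \<beta> "A (Suc m)"] by (simp add: v)
    moreover have "r ^ 2 \<in> F1" unfolding r using sub \<open>\<beta> \<in> F1\<close> \<open>A (Suc m) \<in> F1\<close> subfieldD(7)[of F1] by simp
    moreover have "\<exists>w. w ^ 2 = \<sigma>1 \<beta> - fps_to_fls (v (Suc m))"
      using fls_sqrt_of_root_diff[of v m "\<sigma>1 \<beta>"] unramified[of "Suc m"] Suc.prems
        embedding_root[OF 1(1) \<open>\<beta> \<in> F1\<close> \<open>nest A m \<beta> = 0\<close>] by simp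
    ultimately show ?thesis by simp
  qed
  then obtain F2 \<sigma>2 where 2: "subfield F2 type_ring" "F1 \<subseteq> F2" "?R \<subseteq> F2" "hom_on F2 \<sigma>2" "\<forall>x\<in>F1. \<sigma>2 x = \<sigma>1 x"
    using hom_on_extend_sqrts[OF finite_nest_roots[of A "Suc m"], of F1 \<sigma>1] sub by auto
  have "embedding F2 \<sigma>2" using 2 sub by (auto simp: embedding_def image_subset_iff)
  then show ?case using 1 2 by (intro exI[of _ F2] exI[of _ \<sigma>2]) auto
qed

text \<open>The series \<open>t x\<close> is the image of \<open>A (Suc \<mu>) - x\<close>, which is
  a power series because roots have integral images. Evaluating the factorization of \<gamma>_\<mu>
  at \<open>A (Suc \<mu>)\<close> gives the product.\<close>

lemma embedding_product:
  assumes \<sigma>: "embedding F \<sigma>" and F: "{z. nest A \<mu> z = 0} \<subseteq> F"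
    and M: "\<And>y. nest A \<mu> y = (\<Prod>x\<in>#M. y - x)"
  shows "\<exists>t. nest v (Suc \<mu>) 0 = (\<Prod>x\<in>#M. t x) \<and> (\<forall>x. nest A \<mu> x = 0 \<longrightarrow> \<sigma> x = fps_to_fls (v (Suc \<mu>) - t x))"
proof -
  note sub = \<sigma>[unfolded embedding_def]
  have "\<exists>s. \<sigma> x = fps_to_fls s" if "nest A \<mu> x = 0" for x
    using nest_integral[of v \<mu> "\<sigma> x" 0] embedding_root[OF \<sigma> _ that] F that by auto
  then obtain s where s: "\<And>x. nest A \<mu> x = 0 \<Longrightarrow> \<sigma> x = fps_to_fls (s x)" by metis
  have M0: "nest A \<mu> x = 0" if "x \<in># M" for x using that by (auto simp: M)
  have AF: "A (Suc \<mu>) \<in> F" using sub by auto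
  have "set_mset M \<subseteq> F" using F M0 by auto
  then have "\<sigma> (\<Prod>x\<in>#M. A (Suc \<mu>) - x) = (\<Prod>x\<in>#M. \<sigma> (A (Suc \<mu>)) - \<sigma> x)"
    using hom_on_prod_diff[of F \<sigma> "A (Suc \<mu>)" M] sub AF by blast
  also have "\<dots> = (\<Prod>x\<in>#M. fps_to_fls (v (Suc \<mu>) - s x))"
    by (rule arg_cong[of _ _ prod_mset], rule image_mset_cong) (use sub s M0 v in auto)
  finally have "fps_to_fls (nest v \<mu> (v (Suc \<mu>))) = fps_to_fls (\<Prod>x\<in>#M. v (Suc \<mu>) - s x)"
    using embedding_nest[OF \<sigma> AF, of \<mu>] sub
    by (simp add: M[symmetric] fps_to_fls_prod_mset v nest_hom[OF hom_on_fps_to_fls])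
  then have "nest v (Suc \<mu>) 0 = (\<Prod>x\<in>#M. v (Suc \<mu>) - s x)" by simp
  then show ?thesis using s by (intro exI[of _ "\<lambda>x. v (Suc \<mu>) - s x"]) simp
qed

text \<open>Irreducibility of \<open>\<gamma>\<^sub>\<mu>\<close> allows moving any root \<open>\<beta>\<close> to the one root that meets \<open>a (\<mu> + 1)\<close> at
  the centre of expansion; this replaces transitivity of the Galois group.\<close>

lemma distinguished_embedding:
  assumes \<beta>: "nest A \<mu> \<beta> = 0" and M: "\<And>y. nest A \<mu> y = (\<Prod>x\<in>#M. y - x)"
  shows "\<exists>F \<sigma> t. embedding F \<sigma> \<and> {z. nest A \<mu> z = 0} \<subseteq> F \<and>
    (\<forall>x. nest A \<mu> x = 0 \<longrightarrow> \<sigma> x = fps_to_fls (v (Suc \<mu>) - t x)) \<and>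
    t \<beta> $ 0 = 0 \<and> t \<beta> $ 1 \<noteq> 0 \<and> (\<forall>x\<in>#M - {#\<beta>#}. t x $ 0 \<noteq> 0)"
proof -
  have M0: "x \<in># M \<longleftrightarrow> nest A \<mu> x = 0" for x by (auto simp: M)
  have "hom_on (range to_ac) (\<tau> \<circ> of_ac)"
  proof -
    have "(\<tau> \<circ> of_ac) (to_ac x + to_ac y) = \<tau> x + \<tau> y" "(\<tau> \<circ> of_ac) (to_ac x * to_ac y) = \<tau> x * \<tau> y" for x y
      using hom_onD[OF \<tau>] by (simp_all flip: to_ac_add to_ac_mult)
    then show ?thesis by (auto simp: hom_on_def hom_onD(1)[OF \<tau>])
  qed
  then have "embedding (range to_ac) (\<tau> \<circ> of_ac)"
    using subfield_range_to_ac by (simp add: embedding_def)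
  then obtain F1 \<sigma>1 where 1: "embedding F1 \<sigma>1" "{z. nest A \<mu> z = 0} \<subseteq> F1"
    using embedding_extend_roots[of _ _ \<mu>] by blast
  obtain t where t: "nest v (Suc \<mu>) 0 = (\<Prod>x\<in>#M. t x)"
      "\<And>x. nest A \<mu> x = 0 \<Longrightarrow> \<sigma>1 x = fps_to_fls (v (Suc \<mu>) - t x)"
    using embedding_product[OF 1 M] by blast
  \<comment> \<open>The constant term of the product is 0, so under the first embedding some root x
    meets \<open>A (Suc \<mu>)\<close> at the centre.\<close>
  have "(\<Prod>x\<in>#M. t x $ 0) = 0" using zero unfolding t(1) fps_prod_mset_nth_0 .
  then obtain x where x: "x \<in># M" "t x $ 0 = 0" by auto
  then have "nest A \<mu> x = 0" using M0 by simp
  then have "nest (\<lambda>i. fps_to_fls (v i)) \<mu> (\<sigma>1 x) = 0"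
    using embedding_root[OF 1(1)] 1(2) by blast
  then have "poly (map_poly \<tau> (comp_seq (\<lambda>m. [:a m, 0, 1:]) \<mu>)) (\<sigma>1 x) = 0"
    by (simp add: map_poly_comp_seq[OF \<tau>] poly_comp_seq v)
  moreover have "poly (map_poly to_ac (comp_seq (\<lambda>m. [:a m, 0, 1:]) \<mu>)) \<beta> = 0"
    using \<beta> by (simp add: map_poly_comp_seq[OF hom_on_to_ac] poly_comp_seq)
  \<comment> \<open>A fresh embedding of the field generated by \<beta> sends \<beta> to the image
    of x; it is then extended to all the other roots.\<close>
  ultimately obtain F2 \<sigma>2 where "embedding F2 \<sigma>2" "\<beta> \<in> F2" "\<sigma>2 \<beta> = \<sigma>1 x"
    using hom_on_extend_root[OF irr hom_on_to_ac \<tau>, of \<beta> "\<sigma>1 x"] by (auto simp: embedding_def)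
  then obtain F3 \<sigma>3 where 3: "embedding F3 \<sigma>3" "{z. nest A \<mu> z = 0} \<subseteq> F3" "\<sigma>3 \<beta> = \<sigma>1 x"
    using embedding_extend_roots[of F2 \<sigma>2 \<mu>] by auto
  obtain u where u: "nest v (Suc \<mu>) 0 = (\<Prod>x\<in>#M. u x)"
      "\<And>x. nest A \<mu> x = 0 \<Longrightarrow> \<sigma>3 x = fps_to_fls (v (Suc \<mu>) - u x)"
    using embedding_product[OF 3(1,2) M] by blast
  have "u \<beta> = t x"
    using 3(3) u(2)[OF \<beta>] t(2)[OF \<open>nest A \<mu> x = 0\<close>] by simp
  then have u0: "u \<beta> $ 0 = 0" using x by simp
  have "\<beta> \<in># M" using \<beta> M0 by simp
  then obtain M' where "M = add_mset \<beta> M'" by (metis multi_member_split)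
  then have "nest v (Suc \<mu>) 0 = u \<beta> * (\<Prod>x\<in>#M - {#\<beta>#}. u x)"
    unfolding u(1) by simp
  \<comment> \<open>As \<open>u \<beta>\<close> has no constant term, the linear coefficient of the
    product is that of \<open>u \<beta>\<close> times the constant term of the remaining product.
    Both are nonzero by simplicity of the zero.\<close>
  then have "u \<beta> $ 1 * (\<Prod>x\<in>#M - {#\<beta>#}. u x) $ 0 \<noteq> 0"
    using simple u0 by simp
  then have "u \<beta> $ 1 \<noteq> 0" "\<forall>x\<in>#M - {#\<beta>#}. u x $ 0 \<noteq> 0"
    unfolding fps_prod_mset_nth_0 by auto
  then show ?thesis using 3(1,2) u(2) u0 by blast
qed

text \<open>Removing one copy of \<beta> from \<open>M\<close> leaves only x with nonzero constant
  term of \<open>t x\<close>, while that of \<open>t \<beta>\<close> is 0. So no root is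
  repeated.\<close>

lemma card_roots: "card {z. nest A \<mu> z = 0} = 2 ^ \<mu>"
proof -
  obtain M where M: "size M = 2 ^ \<mu>" "\<And>y. nest A \<mu> y = (\<Prod>x\<in>#M. y - x)"
    using nest_factorization[of \<mu> A] by blast
  have M0: "set_mset M = {z. nest A \<mu> z = 0}" by (auto simp: M(2))
  have "count M \<beta> = 1" if "\<beta> \<in># M" for \<beta>
  proof -
    have "\<beta> \<notin># M - {#\<beta>#}" using distinguished_embedding[OF _ M(2), of \<beta>] that M0 by auto
    then have "\<not> count M \<beta> > 1" by (simp add: in_diff_count)
    moreover have "count M \<beta> > 0" using that by simp
    ultimately show ?thesis by linarith
  qed
  then have "size M = card (set_mset M)" by (simp add: size_multiset_overloaded_eq)
  then show ?thesis using M(1) M0 by simp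
qed

text \<open>Use the embedding distinguished at \<beta>. The squares of all elements of
  \<open>R\<close> have unit images, so it extends to a field containing \<open>R\<close>. There
  \<open>r\<close> cannot lie, as the image of \<open>r ^ 2\<close> has valuation 1.\<close>

lemma sqrt_not_in_field:
  assumes \<beta>: "nest A \<mu> \<beta> = 0" and r: "r ^ 2 = \<beta> - A (Suc \<mu>)" and "finite R"
    and R: "\<And>r'. r' \<in> R \<Longrightarrow> nest A (Suc \<mu>) r' = 0 \<and> r' ^ 2 \<noteq> r ^ 2"
  shows "r \<notin> generate_field type_ring (range to_ac \<union> {z. nest A \<mu> z = 0} \<union> R)"
proof -
  obtain M where M: "\<And>y. nest A \<mu> y = (\<Prod>x\<in>#M. y - x)"
    using nest_factorization[of \<mu> A] by blast
  obtain F \<sigma> t where \<sigma>: "embedding F \<sigma>" and F: "{z. nest A \<mu> z = 0} \<subseteq> F"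
    and t: "\<And>x. nest A \<mu> x = 0 \<Longrightarrow> \<sigma> x = fps_to_fls (v (Suc \<mu>) - t x)"
    and t0: "t \<beta> $ 0 = 0" and t1: "t \<beta> $ 1 \<noteq> 0" and tX: "\<And>x. x \<in># M - {#\<beta>#} \<Longrightarrow> t x $ 0 \<noteq> 0"
    using distinguished_embedding[OF \<beta> M] by blast
  note sub = \<sigma>[unfolded embedding_def]
  have diff: "x - A (Suc \<mu>) \<in> F \<and> \<sigma> (x - A (Suc \<mu>)) = fps_to_fls (- t x)" if "nest A \<mu> x = 0" for x
  proof -
    have "x \<in> F" "A (Suc \<mu>) \<in> F" using that F sub by auto
    then show ?thesis
      using sub t[OF that] subfieldD(2,5,7)[of F] hom_on_diff[of F \<sigma> x "A (Suc \<mu>)"] by (simp add: v)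
  qed
  have "r' ^ 2 \<in> F \<and> (\<exists>w. w ^ 2 = \<sigma> (r' ^ 2))" if "r' \<in> R" for r'
  proof -
    define x where "x = r' ^ 2 + A (Suc \<mu>)"
    have x: "nest A \<mu> x = 0" "x \<noteq> \<beta>" and r': "r' ^ 2 = x - A (Suc \<mu>)"
      using R[OF that] r by (auto simp: x_def)
    then have "x \<in># M - {#\<beta>#}" using M by (auto simp: in_diff_count)
    then show ?thesis
      using tX[of x] diff[OF x(1)] fls_sqrt_of_unit[of "- t x"] by (simp add: r')
  qed
  then obtain F' \<sigma>' where F': "subfield F' type_ring" "F \<subseteq> F'" "R \<subseteq> F'" "hom_on F' \<sigma>'" "\<forall>x\<in>F. \<sigma>' x = \<sigma> x"
    using hom_on_extend_sqrts[OF \<open>finite R\<close>, of F \<sigma>] sub by auto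
  have "r \<notin> F'"
  proof
    assume "r \<in> F'"
    then have "\<sigma>' r ^ 2 = \<sigma>' (r ^ 2)" using hom_onD(3)[OF F'(4)] by (simp add: power2_eq_square)
    also have "\<dots> = fps_to_fls (- t \<beta>)" using F'(5) diff[OF \<beta>] by (simp add: r)
    finally have sq: "\<sigma>' r ^ 2 = fps_to_fls (- t \<beta>)" .
    then obtain q where "\<sigma>' r = fps_to_fls q" using fls_integral_of_square by blast
    then have "q ^ 2 = - t \<beta>" using sq by (metis fps_to_fls_power fps_to_fls_eq_iff)
    \<comment> \<open>If \<open>q\<close> has constant term 0, then \<open>q * q\<close> has linear
      coefficient 0, contrary to the choice of \<open>t \<beta>\<close>.\<close>
    then have q: "t \<beta> = - (q * q)" by (simp add: power2_eq_square)
    then show False using t0 t1 by simp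
  qed
  moreover have "generate_field type_ring (range to_ac \<union> {z. nest A \<mu> z = 0} \<union> R) \<subseteq> F'"
    using F F' sub by (intro generate_field_type_ring(3)) auto
  ultimately show ?thesis by blast
qed

lemma dimension_step:
  "ring.dimension type_ring (2 ^ 2 ^ \<mu>)
    (generate_field type_ring (range to_ac \<union> {z. nest A \<mu> z = 0}))
    (generate_field type_ring (range to_ac \<union> {z. nest A (Suc \<mu>) z = 0}))"
proof -
  note G = generate_field_type_ring
  let ?B = "{z. nest A \<mu> z = 0}" and ?C = "{z. nest A (Suc \<mu>) z = 0}"
  let ?H = "range to_ac \<union> ?B"
  have "\<exists>r. r ^ 2 = \<beta> - A (Suc \<mu>)" for \<beta>
    using nth_root_exists[of 2 "\<beta> - A (Suc \<mu>)"] by auto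
  then obtain \<rho> where \<rho>: "\<And>\<beta>. \<rho> \<beta> ^ 2 = \<beta> - A (Suc \<mu>)" by metis
  have "ring.dimension type_ring (2 ^ card ?B) (generate_field type_ring ?H) (generate_field type_ring (?H \<union> \<rho> ` ?B))"
  proof (rule dimension_adjoin_sqrts[OF finite_nest_roots])
    show "\<rho> \<beta> ^ 2 \<in> generate_field type_ring ?H" if "\<beta> \<in> ?B" for \<beta>
      unfolding \<rho> using G(2)[of ?H] that by (intro subfieldD(7)[OF G(1)]) auto
    show "\<rho> \<beta> \<notin> generate_field type_ring (?H \<union> \<rho> ` T)" if "\<beta> \<in> ?B" "T \<subseteq> ?B - {\<beta>}" for \<beta> T
    proof (rule sqrt_not_in_field[OF _ \<rho>])
      show "finite (\<rho> ` T)"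
        using that(2) finite_nest_roots[of A \<mu>] by (meson finite_imageI finite_subset finite_Diff)
      show "nest A (Suc \<mu>) r' = 0 \<and> r' ^ 2 \<noteq> \<rho> \<beta> ^ 2" if "r' \<in> \<rho> ` T" for r'
        using that \<open>T \<subseteq> ?B - {\<beta>}\<close> by (auto simp: \<rho>)
    qed (use that in simp)
  qed
  \<comment> \<open>The roots of \<gamma>_(\<mu>+1) are the \<rho> \<beta> and their negatives, and
    \<beta> is recovered as the square of \<rho> \<beta> plus \<open>A (Suc \<mu>)\<close>.\<close>
  moreover have "generate_field type_ring (?H \<union> \<rho> ` ?B) = generate_field type_ring (range to_ac \<union> ?C)"
  proof (rule antisym)
    have \<rho>C: "\<rho> ` ?B \<subseteq> ?C" by (auto simp: \<rho>)
    have "\<beta> \<in> generate_field type_ring (range to_ac \<union> ?C)" if "\<beta> \<in> ?B" for \<beta>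
    proof -
      have "\<beta> = \<rho> \<beta> * \<rho> \<beta> + A (Suc \<mu>)" using \<rho>[of \<beta>] by (simp add: power2_eq_square)
      moreover have "\<rho> \<beta> \<in> generate_field type_ring (range to_ac \<union> ?C)"
        "A (Suc \<mu>) \<in> generate_field type_ring (range to_ac \<union> ?C)"
        using \<rho>C that G(2)[of "range to_ac \<union> ?C"] by auto
      ultimately show ?thesis by (metis subfieldD(3,4)[OF G(1)])
    qed
    then show "generate_field type_ring (?H \<union> \<rho> ` ?B) \<subseteq> generate_field type_ring (range to_ac \<union> ?C)"
      using \<rho>C G(2)[of "range to_ac \<union> ?C"] by (intro G(3)[OF G(1)]) auto
    have "z \<in> generate_field type_ring (?H \<union> \<rho> ` ?B)" if "z \<in> ?C" for z
    proof -
      define \<beta> where "\<beta> = z ^ 2 + A (Suc \<mu>)"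
      have "\<beta> \<in> ?B" "z ^ 2 = \<rho> \<beta> ^ 2" using that by (simp_all add: \<rho> \<beta>_def)
      then have "z = \<rho> \<beta> \<or> z = - \<rho> \<beta>" "\<rho> \<beta> \<in> generate_field type_ring (?H \<union> \<rho> ` ?B)"
        using G(2)[of "?H \<union> \<rho> ` ?B"] by (auto simp: power2_eq_iff)
      then show ?thesis using subfieldD(5)[OF G(1)] by auto
    qed
    then show "generate_field type_ring (range to_ac \<union> ?C) \<subseteq> generate_field type_ring (?H \<union> \<rho> ` ?B)"
      using G(2)[of "?H \<union> \<rho> ` ?B"] by (intro G(3)[OF G(1)]) auto
  qed
  ultimately show ?thesis by (simp add: card_roots)
qed

end

section \<open>Stability and maximality for sequences over Q(t)\<close>

lemma splitting_field_comp_seq: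
  fixes a :: "nat \<Rightarrow> 'a::field"
  shows "splitting_field (comp_seq (\<lambda>m. [:a m, 0, 1:]) m) =
    generate_field type_ring (range to_ac \<union> {z. nest (\<lambda>i. to_ac (a i)) m z = 0})"
  by (simp add: splitting_field_def map_poly_comp_seq[OF hom_on_to_ac] poly_comp_seq)

theorem theorem1p6:
  fixes s :: nat
    and c :: "nat \<Rightarrow> int poly"
    and \<theta> :: "nat \<Rightarrow> Qt poly"
    and j k n :: nat
  assumes j: "j \<in> {1..s}"
    and k: "k \<in> {1..s}"
    and deriv_cj: "pderiv (red2 (c j)) = 1"
    and odd_ck: "odd (Polynomial.lead_coeff (c k))"
    and deg_ck: "Polynomial.degree (c k) = Max ((\<lambda>i. Polynomial.degree (c i)) ` {1..s})"
    and seq: "\<And>m. m \<ge> 1 \<Longrightarrow> \<theta> m \<in> (\<lambda>i. quad (c i)) ` {1..s}"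
    and first: "poly (\<theta> 1) 0 = Qt_of (c j)"
    and n: "n \<ge> 1"
    and nth: "poly (\<theta> n) 0 = Qt_of (c k)"
  shows "stable_seq \<theta> \<and> maximal_ext \<theta> n"
proof -
  \<comment> \<open>At m = 0, where the sequence carries no information, \<open>j\<close> serves as
    a witness. So every \<open>b m\<close> is one of the given polynomials and the degree bound
    holds for all indices.\<close>
  have "\<exists>i. i \<in> {1..s} \<and> (m \<ge> 1 \<longrightarrow> \<theta> m = quad (c i))" for m
    using seq[of m] j by (cases "m \<ge> 1") auto
  then obtain idx where idx: "\<And>m. idx m \<in> {1..s}" "\<And>m. m \<ge> 1 \<Longrightarrow> \<theta> m = quad (c (idx m))"
    by metis
  define b where "b m = c (idx m)" for m
  define a where "a m = Qt_of (b m)" for m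
  have \<theta>: "comp_seq \<theta> m = comp_seq (\<lambda>m. [:a m, 0, 1:]) m" for m
    by (rule comp_seq_cong) (simp add: idx(2) quad_def a_def b_def)
  have b1: "b 1 = c j"
    using first idx(2)[of 1] by (simp add: quad_def Qt_of_eq_iff b_def)
  have bn: "b n = c k"
    using nth idx(2)[OF n] by (simp add: quad_def Qt_of_eq_iff b_def)
  have deriv: "pderiv (red2 (nest b m 0)) = 1" if "m \<ge> 1" for m
    using pderiv_red2_nest[of b m 0] deriv_cj b1 that by simp
  have nest_a: "nest a m 0 = Qt_of (nest b m 0)" for m
    using nest_hom[OF hom_on_Qt_of, of b m 0] hom_on_zero[OF hom_on_Qt_of] by (simp add: a_def[abs_def])
  have "q ^ 2 \<noteq> nest a m 0" "q ^ 2 \<noteq> - nest a m 0" if "m \<ge> 1" for m q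
    using Qt_of_not_square[OF deriv[OF that]] Qt_of_not_square[OF pderiv_red2_uminus[OF deriv[OF that]]]
      hom_on_uminus[OF hom_on_Qt_of, of "nest b m 0"] by (simp_all add: nest_a)
  then have irr: "Factorial_Ring.irreducible (comp_seq (\<lambda>m. [:a m, 0, 1:]) m)" for m
    by (rule irreducible_comp_seq)
  obtain \<mu> where \<mu>: "n = Suc \<mu>" using n by (cases n) auto
  have "Polynomial.degree (b i) \<le> Polynomial.degree (b (Suc \<mu>))" for i
    using idx(1)[of i] deg_ck bn by (simp add: \<mu> b_def[of i])
  then obtain z :: complex where z: "poly (map_poly of_int (nest b (Suc \<mu>) 0)) z = 0"
      "poly (pderiv (map_poly of_int (nest b (Suc \<mu>) 0))) z \<noteq> 0"
      "\<forall>i\<in>{1..\<mu>}. poly (map_poly of_int (nest b i 0)) z \<noteq> 0"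
    using exists_primitive_simple_root[of b \<mu>] odd_ck deriv_cj b1 bn by (auto simp: \<mu>)
  obtain \<tau> :: "Qt \<Rightarrow> complex fls" where \<tau>: "hom_on UNIV \<tau>" "\<And>c. \<tau> (Qt_of c) = fps_to_fls (expansion z c)"
    using Qt_laurent_expansion[of z] by blast
  define v where "v i = expansion z (b i)" for i
  have v: "nest v i 0 = expansion z (nest b i 0)" for i
    using nest_hom[OF hom_on_expansion, of z b i 0] hom_on_zero[OF hom_on_expansion, of z] by (simp add: v_def[abs_def])
  \<comment> \<open>The three properties of \<open>z\<close> become conditions on the constant and
    linear coefficients of the expansions at \<open>z\<close>.\<close>
  have "laurent_point a \<tau> v \<mu>"
  proof
    show "\<tau> (a i) = fps_to_fls (v i)" for i by (simp add: a_def \<tau>(2) v_def)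
    show "nest v i 0 $ 0 \<noteq> 0" if "i \<in> {1..\<mu>}" for i
      using z(3) that unfolding v expansion_nth_0 by blast
    show "nest v (Suc \<mu>) 0 $ 0 = 0" unfolding v expansion_nth_0 by (rule z)
    show "nest v (Suc \<mu>) 0 $ 1 \<noteq> 0" unfolding v expansion_nth_1 by (rule z)
  qed (fact \<tau>(1), fact irr)
  from laurent_point.dimension_step[OF this] have "maximal_ext \<theta> n"
    by (simp add: maximal_ext_def seq_field_def \<theta> splitting_field_comp_seq \<mu> del: nest.simps comp_seq.simps)
  moreover have "stable_seq \<theta>"
    using irr by (simp add: stable_seq_def \<theta>)
  ultimately show ?thesis by blast
qed

end
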